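(* For every real $k\in(0,1)$, $$\sum_{n=0}^\infty \frac{(\frac13)_n(\frac23)_n}{n!^2}\,P_n\!\left(\frac{1-4k+6k^2-4k^3+10k^4}{(1-2k-2k^2)(1-2k+4k^2)}\right)\left(\frac{(1+k+k^2)(1-2k-2k^2)(1-2k+4k^2)}{(1+2k)^3}\right)^n\bigl(C_3n^3+C_2n^2+C_1n+C_0\bigr)=\frac{\sqrt3\,(1+2k)^4(1-2k+4k^2)}{\pi},$$ where $$C_3=\frac{9(k-1)^2k^2}{1+k+k^2}(3+4k+2k^2)^2(3+2k+4k^2)^2,$$ $$C_2=27(k-1)k(9-18k+10k^2+12k^3+60k^4+160k^5+240k^6+192k^7+64k^8),$$ $$C_1=9-144k+540k^2-584k^3+314k^4-228k^5-1256k^6-1072k^7+768k^8+2560k^9+1280k^{10},$$ $$C_0=2(1-2k-2k^2)^2(1-10k+12k^2-24k^3+16k^4+32k^6).$$ At the single value $k=\frac{\sqrt3-1}{2}$ (where $1-2k-2k^2=0$), the product $P_n(\cdot)\,(\cdot)^n$ in each summand is understood as its limit as $k\to\frac{\sqrt3-1}{2}$.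
   Context: $P_n$ denotes the $n$-th Legendre polynomial, $P_n(x)={}_2F_1\bigl(-n,n+1;1;\tfrac{1-x}{2}\bigr)$, evaluated at any real $x$ (possibly $|x|>1$). $(a)_n=a(a+1)\cdots(a+n-1)$, $(a)_0=1$, is the Pochhammer symbol. *)

theory Defs
  imports "HOL-Analysis.Analysis"
begin

text \<open>
  \<open>P\<^sub>n(x) = \<^sub>2F\<^sub>1(-n, n+1; 1; (1-x)/2)\<close>. The series terminates, so it is defined for all real \<open>x\<close>;
  see \<open>legendre_P_altdef\<close>.
\<close>

definition legendre_P :: "nat \<Rightarrow> real \<Rightarrow> real" where
  "legendre_P n x = eval_fps (fps_hypergeo [- real n, real n + 1] [1] 1) ((1 - x) / 2)"

definition arg_x :: "real \<Rightarrow> real" where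
  "arg_x k = (1 - 4*k + 6*k^2 - 4*k^3 + 10*k^4) / ((1 - 2*k - 2*k^2) * (1 - 2*k + 4*k^2))"

definition arg_z :: "real \<Rightarrow> real" where
  "arg_z k = (1 + k + k^2) * (1 - 2*k - 2*k^2) * (1 - 2*k + 4*k^2) / (1 + 2*k)^3"

text \<open>
  The product \<open>P\<^sub>n(x) z\<^sup>n\<close>. At the zero of \<open>1 - 2k - 2k\<^sup>2\<close> in \<open>(0,1)\<close>, where \<open>x\<close> has a pole and \<open>z\<close>
  vanishes, it is the limit of the product (which exists: \<open>legendre_term_tendsto\<close>).
\<close>

definition legendre_term :: "nat \<Rightarrow> real \<Rightarrow> real" where
  "legendre_term n k =
     (if k = (sqrt 3 - 1) / 2
      then Lim (at k) (\<lambda>t. legendre_P n (arg_x t) * arg_z t ^ n)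
      else legendre_P n (arg_x k) * arg_z k ^ n)"

definition C3 :: "real \<Rightarrow> real" where
  "C3 k = 9 * (k - 1)^2 * k^2 / (1 + k + k^2) * (3 + 4*k + 2*k^2)^2 * (3 + 2*k + 4*k^2)^2"

definition C2 :: "real \<Rightarrow> real" where
  "C2 k = 27 * (k - 1) * k *
     (9 - 18*k + 10*k^2 + 12*k^3 + 60*k^4 + 160*k^5 + 240*k^6 + 192*k^7 + 64*k^8)"

definition C1 :: "real \<Rightarrow> real" where
  "C1 k = 9 - 144*k + 540*k^2 - 584*k^3 + 314*k^4 - 228*k^5 - 1256*k^6 - 1072*k^7
     + 768*k^8 + 2560*k^9 + 1280*k^10"

definition C0 :: "real \<Rightarrow> real" where
  "C0 k = 2 * (1 - 2*k - 2*k^2)^2 * (1 - 10*k + 12*k^2 - 24*k^3 + 16*k^4 + 32*k^6)"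

lemma legendre_P_altdef:
  "legendre_P n x = (\<Sum>j\<le>n. pochhammer (- real n) j * pochhammer (real n + 1) j / (fact j)^2
                       * ((1 - x) / 2)^j)"
proof -
  have "legendre_P n x = (\<Sum>j. pochhammer (- real n) j * pochhammer (real n + 1) j / (fact j)^2
                       * ((1 - x) / 2)^j)"
    by (simp add: legendre_P_def eval_fps_def pochhammer_fact [symmetric] power2_eq_square)
  also have "\<dots> = (\<Sum>j\<le>n. pochhammer (- real n) j * pochhammer (real n + 1) j / (fact j)^2
                       * ((1 - x) / 2)^j)"
    by (rule suminf_finite) (auto simp: pochhammer_of_nat_eq_0_iff)
  finally show ?thesis .
qed

lemma legendre_term_tendsto:
  assumes "k = (sqrt 3 - 1) / 2"
  shows "((\<lambda>t. legendre_P n (arg_x t) * arg_z t ^ n) \<longlongrightarrow> legendre_term n k) (at k)"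
proof -
  define w where "w = (\<lambda>t::real. (1 + t + t^2) * (1 - 4*t + 6*t^2 - 4*t^3 + 10*t^4) / (1 + 2*t)^3)"
  define F where "F = (\<lambda>t. \<Sum>j\<le>n. pochhammer (- real n) j * pochhammer (real n + 1) j / (fact j)^2
                       * (((arg_z t - w t) / 2)^j * arg_z t ^ (n - j)))"
  have k_sqrt: "2 * k + 1 = sqrt 3"
    using assms by simp
  hence "(2 * k + 1)^2 = 3"
    by simp
  hence k3: "2 * k^2 = 1 - 2*k"
    by (simp add: power2_eq_square algebra_simps)
  have "k > 0"
    unfolding assms by simp
  moreover have "2 * k + 1 < 3"
    unfolding k_sqrt by (rule real_less_lsqrt) auto
  hence "k < 1"
    by linarith
  ultimately have k: "k > 0" "k < 1" "2 * k^2 = 1 - 2*k"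
    using k3 by blast+
  have "isCont F k"
    unfolding F_def w_def arg_z_def using k by (intro continuous_intros) auto
  hence 1: "(F \<longlongrightarrow> F k) (at k)"
    by (simp add: isCont_def)
  have eq: "F t = legendre_P n (arg_x t) * arg_z t ^ n" if t: "0 < t" "t < 1" "t \<noteq> k" for t
  proof -
    have "(1 - 2*t - 2*t^2) = 2 * (k - t) * (k + t + 1)"
      using k by (simp add: power2_eq_square algebra_simps)
    hence nz: "1 - 2*t - 2*t^2 \<noteq> 0"
      using t k by auto
    have "1 - 2*t + 4*t^2 = (1 - t)^2 + 3*t^2"
      by (simp add: power2_eq_square algebra_simps)
    hence nz': "1 - 2*t + 4*t^2 \<noteq> 0"
      using t by (metis add_nonneg_pos less_irrefl mult_pos_pos zero_le_power2 zero_less_numeral zero_less_power)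
    have "arg_x t * arg_z t = w t"
      using nz nz' by (simp add: arg_x_def arg_z_def w_def)
    hence *: "(arg_z t - w t) / 2 = (1 - arg_x t) / 2 * arg_z t"
      by (simp add: algebra_simps diff_divide_distrib)
    show ?thesis
      unfolding F_def legendre_P_altdef sum_distrib_right
    proof (rule sum.cong, goal_cases)
      case (2 j)
      have "arg_z t ^ n = arg_z t ^ j * arg_z t ^ (n - j)"
        using 2 by (simp add: power_add [symmetric])
      thus ?case
        by (simp only: * power_mult_distrib mult_ac)
    qed auto
  qed
  have "eventually (\<lambda>t. t \<in> {0<..<1}) (nhds k)"
    using k by (intro eventually_nhds_in_open) auto
  hence "eventually (\<lambda>t. F t = legendre_P n (arg_x t) * arg_z t ^ n) (at k)"
    unfolding eventually_at_filter by eventually_elim (use eq in auto)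
  hence 2: "((\<lambda>t. legendre_P n (arg_x t) * arg_z t ^ n) \<longlongrightarrow> F k) (at k)"
    using 1 by (rule Lim_transform_eventually[rotated])
  have "legendre_term n k = F k"
    unfolding legendre_term_def if_P[OF assms] by (rule tendsto_Lim[OF _ 2]) simp
  thus ?thesis
    using 2 by simp
qed

end

theory Submission
  imports Defs
begin

text \<open>
  Write \<open>x = k\<^sup>3\<close>, \<open>y = ((1-k)/(1+2k))\<^sup>3\<close> and \<open>F = \<^sub>2F\<^sub>1(1/3, 2/3; 1; \<cdot>)\<close>. The argument of \<open>P\<^sub>n\<close> and the base of
  the power in the theorem are \<open>(x+y-2xy)/(y-x)\<close> and \<open>z = y-x\<close>, so Brafman's formula
  \<open>\<Sum>n. (s)\<^sub>n(1-s)\<^sub>n/n!\<^sup>2 P\<^sub>n z\<^sup>n = F(x) F(y)\<close> applies.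

  Brafman's formula: with \<open>Q\<^sub>n = P\<^sub>n z\<^sup>n\<close> and \<open>L = \<partial>\<^sub>x x(1-x) \<partial>\<^sub>x\<close> one has
  \<open>L Q\<^sub>n = n\<^sup>2 Q\<^sub>n\<^sub>-\<^sub>1 - n(n+1) Q\<^sub>n\<close>. Hence for the partial sums of the series, \<open>L - s(1-s)\<close>
  telescopes to a single vanishing term, while it annihilates \<open>F(x)\<close>; at \<open>x = 0\<close> the series is \<open>F(y)\<close>.

  The weights \<open>n\<^sup>j\<close> come from applying \<open>t d/dt\<close> along the curve through \<open>(x,y)\<close> on which \<open>Q\<^sub>n\<close> scales as
  \<open>t\<^sup>n\<close>. The polynomials \<open>C\<^sub>j\<close> are such that \<open>F'(x) F'(y)\<close> drops out of the combination, leaving a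
  multiple of the Wronskian of \<open>F(x)\<close> and \<open>F(y)/(1+2k)\<close>. Both solve the same second order
  equation in \<open>k\<close>, so the Wronskian is explicit up to a constant, found by letting \<open>k \<rightarrow> 1\<close>.
\<close>

section \<open>The hypergeometric function and its behaviour at 1\<close>

text \<open>The weights \<open>(1 - x) * x ^ n\<close> sum to 1, and as \<open>x\<close> approaches
  1 the mass on any fixed initial segment vanishes, so only the tail of \<open>a\<close>, which is
  close to \<open>L\<close>, counts. Applied to \<open>n\<close> times the coefficient it gives
  \<open>hyp_D\<close> at 1, applied to the coefficient itself \<open>hyp_F\<close>.\<close>

lemma tendsto_Abel_mean:
  fixes a :: "nat \<Rightarrow> real"
  assumes "a \<longlonglongrightarrow> L"
  shows "((\<lambda>x. (1 - x) * (\<Sum>n. a n * x ^ n)) \<longlongrightarrow> L) (at_left 1)"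
proof -
  have "Bseq a" using assms convergent_imp_Bseq convergent_def by blast
  then obtain B where B: "\<And>n. \<bar>a n\<bar> \<le> B" "B > 0" by (auto simp: Bseq_def)
  have sm: "summable (\<lambda>n. b n * x ^ n)" if "0 \<le> x" "x < 1" "\<And>n. \<bar>b n\<bar> \<le> C" for x C :: real and b
  proof (rule summable_comparison_test')
    show "summable (\<lambda>n. C * x ^ n)"
      using that by (intro summable_mult summable_geometric) auto
    show "norm (b n * x ^ n) \<le> C * x ^ n" for n
      using that by (auto simp: abs_mult intro!: mult_right_mono)
  qed
  show ?thesis
  proof (rule tendstoI)
    fix e :: real assume e: "e > 0"
    obtain N where N: "\<And>n. n \<ge> N \<Longrightarrow> \<bar>a n - L\<bar> < e / 2"
      using LIMSEQ_D[OF assms, of "e/2"] e by auto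
    \<comment> \<open>The first \<open>N\<close> terms contribute at most
      \<open>(1 - x) * C\<close>, which vanishes in the limit; the tail contributes at most
      \<open>e / 2\<close>.\<close>
    define C where "C = (\<Sum>n<N. \<bar>a n - L\<bar>)"
    have "((\<lambda>x::real. (1 - x) * C + e / 2) \<longlongrightarrow> (1 - 1) * C + e / 2) (at_left 1)"
      by (intro tendsto_intros)
    hence "eventually (\<lambda>x. (1 - x) * C + e / 2 < e) (at_left 1)"
      by (rule order_tendstoD) (use e in auto)
    moreover have "eventually (\<lambda>x::real. x \<in> {0<..<1}) (at_left 1)"
      by (rule eventually_at_left_real) auto
    ultimately show "eventually (\<lambda>x. dist ((1 - x) * (\<Sum>n. a n * x ^ n)) L < e) (at_left 1)"
    proof eventually_elim
      case (elim x)
      hence x: "0 < x" "x < 1" by auto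
      have ge: "(\<lambda>n. x ^ n) sums (1 / (1 - x))" using x by (intro geometric_sums) auto
      have bd: "\<bar>a n - L\<bar> \<le> B + \<bar>L\<bar>" for n using B(1)[of n] by linarith
      have s1: "summable (\<lambda>n. (a n - L) * x ^ n)" using x bd by (intro sm) auto
      have s2: "summable (\<lambda>n. \<bar>a n - L\<bar> * x ^ n)" using x bd by (intro sm) auto
      have "(\<lambda>n. (a n - L) * x ^ n + L * x ^ n) sums ((\<Sum>n. (a n - L) * x ^ n) + L * (1 / (1 - x)))"
        by (intro sums_add sums_mult summable_sums s1 ge)
      hence "(\<Sum>n. a n * x ^ n) = (\<Sum>n. (a n - L) * x ^ n) + L * (1 / (1 - x))"
        by (simp add: sums_iff algebra_simps)
      hence "(1 - x) * (\<Sum>n. a n * x ^ n) - L = (1 - x) * (\<Sum>n. (a n - L) * x ^ n)"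
        using x by (simp add: field_simps)
      also have "\<bar>\<dots>\<bar> \<le> (1 - x) * (\<Sum>n. \<bar>a n - L\<bar> * x ^ n)"
        using summable_rabs[of "\<lambda>n. (a n - L) * x ^ n"] s2 x by (simp add: abs_mult)
      also have "(\<Sum>n. \<bar>a n - L\<bar> * x ^ n) = (\<Sum>n. \<bar>a (n + N) - L\<bar> * x ^ (n + N)) + (\<Sum>n<N. \<bar>a n - L\<bar> * x ^ n)"
        by (rule suminf_split_initial_segment[OF s2])
      also have "\<dots> \<le> (\<Sum>n. e / 2 * x ^ n) + C"
      proof (rule add_mono)
        show "(\<Sum>n. \<bar>a (n + N) - L\<bar> * x ^ (n + N)) \<le> (\<Sum>n. e / 2 * x ^ n)"
        proof (rule suminf_le)
          show "\<bar>a (n + N) - L\<bar> * x ^ (n + N) \<le> e / 2 * x ^ n" for n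
            using N[of "n + N"] x e by (intro mult_mono power_decreasing) auto
          show "summable (\<lambda>n. \<bar>a (n + N) - L\<bar> * x ^ (n + N))"
            using s2 by (rule summable_ignore_initial_segment)
          show "summable (\<lambda>n. e / 2 * x ^ n)"
            using ge by (intro summable_mult) (auto simp: sums_iff)
        qed
        show "(\<Sum>n<N. \<bar>a n - L\<bar> * x ^ n) \<le> C"
          unfolding C_def using x by (intro sum_mono mult_left_le power_le_one) auto
      qed
      also have "(\<Sum>n. e / 2 * x ^ n) = e / 2 * (1 / (1 - x))"
        using sums_mult[OF ge, of "e/2"] by (simp add: sums_iff)
      also have "(1 - x) * (e / 2 * (1 / (1 - x)) + C) = (1 - x) * C + e / 2"
        using x by (simp add: field_simps)
      also have "\<dots> < e" using elim by simp
      finally show ?case using x by (simp add: dist_real_def)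
    qed
  qed
qed

section \<open>Coefficients, power series and differential equation of 2F1(s, 1-s; 1; x)\<close>

definition hyp_coeff :: "real \<Rightarrow> nat \<Rightarrow> real" where
  "hyp_coeff s n = pochhammer s n * pochhammer (1 - s) n / (fact n)\<^sup>2"

lemma hyp_coeff_0 [simp]: "hyp_coeff s 0 = 1"
  by (simp add: hyp_coeff_def)

text \<open>The ratio of consecutive coefficients has numerator
  \<open>(n + s) * (n + 1 - s)\<close>. Written as \<open>n * (n + 1) + s * (1 - s)\<close> it
  splits off the eigenvalue \<open>s * (1 - s)\<close>, which makes the sums below
  telescope.\<close>

lemma hyp_coeff_Suc:
  "(real n + 1)\<^sup>2 * hyp_coeff s (Suc n) = (real n * (real n + 1) + s * (1 - s)) * hyp_coeff s n"
proof -
  have "(fact (Suc n) :: real)\<^sup>2 = (real n + 1)\<^sup>2 * (fact n)\<^sup>2"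
    by (simp add: power_mult_distrib add.commute)
  thus ?thesis
    by (simp add: hyp_coeff_def pochhammer_Suc del: fact_Suc) (simp add: algebra_simps)
qed

lemma hyp_coeff_bounds:
  assumes "0 < s" "s < 1"
  shows "0 \<le> hyp_coeff s n" "hyp_coeff s n \<le> 1"
proof -
  have "0 \<le> hyp_coeff s n \<and> hyp_coeff s n \<le> 1"
  proof (induction n)
    case (Suc n)
    have s: "0 < s * (1 - s)" "s * (1 - s) \<le> 1"
      using assms by (auto intro!: mult_le_one)
    have "0 \<le> (real n + 1)\<^sup>2 * hyp_coeff s (Suc n)"
      using Suc s by (subst hyp_coeff_Suc) (intro mult_nonneg_nonneg, auto)
    moreover have "(real n + 1)\<^sup>2 * hyp_coeff s (Suc n) \<le> (real n + 1)\<^sup>2 * 1"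
      unfolding hyp_coeff_Suc
    proof (rule mult_mono)
      have "real n * (real n + 1) + s * (1 - s) \<le> real n * (real n + 1) + 1"
        using s by simp
      also have "\<dots> \<le> (real n + 1)\<^sup>2"
        by (simp add: power2_eq_square algebra_simps)
      finally show "real n * (real n + 1) + s * (1 - s) \<le> (real n + 1)\<^sup>2" .
    qed (use Suc in auto)
    ultimately show ?case
      by (simp add: zero_le_mult_iff mult_le_cancel_left)
  qed auto
  thus "0 \<le> hyp_coeff s n" "hyp_coeff s n \<le> 1" by auto
qed

definition hyp_F :: "real \<Rightarrow> real \<Rightarrow> real" where
  "hyp_F s x = (\<Sum>n. hyp_coeff s n * x ^ n)"

text \<open>\<open>x (1 - x) F'(x)\<close>: the flux variable that makes the hypergeometric equation a first order system.\<close>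

definition hyp_D :: "real \<Rightarrow> real \<Rightarrow> real" where
  "hyp_D s x = (1 - x) * (\<Sum>n. real n * hyp_coeff s n * x ^ n)"

context
  fixes s :: real
  assumes s: "0 < s" "s < 1"
begin

lemma hyp_F_sums:
  assumes "\<bar>x\<bar> < 1"
  shows "(\<lambda>n. hyp_coeff s n * x ^ n) sums hyp_F s x"
proof -
  have "summable (\<lambda>n. hyp_coeff s n * x ^ n)"
  proof (rule summable_comparison_test')
    show "summable (\<lambda>n. \<bar>x\<bar> ^ n)"
      using assms by (intro summable_geometric) auto
    show "norm (hyp_coeff s n * x ^ n) \<le> \<bar>x\<bar> ^ n" if "n \<ge> 0" for n
      using hyp_coeff_bounds[OF s, of n] by (auto simp: abs_mult power_abs intro!: mult_left_le_one_le)
  qed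
  thus ?thesis by (simp add: hyp_F_def summable_sums)
qed

lemma hyp_F_deriv:
  assumes "\<bar>x\<bar> < 1"
  shows "(hyp_F s has_real_derivative (\<Sum>n. diffs (hyp_coeff s) n * x ^ n)) (at x)"
    and "(\<lambda>n. real n * hyp_coeff s n * x ^ n) sums (x * (\<Sum>n. diffs (hyp_coeff s) n * x ^ n))"
proof -
  have *: "summable (\<lambda>n. hyp_coeff s n * y ^ n)" if "norm y < 1" for y
    using hyp_F_sums[of y] that by (auto dest: sums_summable)
  have "((\<lambda>x. \<Sum>n. hyp_coeff s n * x ^ n) has_real_derivative (\<Sum>n. diffs (hyp_coeff s) n * x ^ n)) (at x)"
    by (rule termdiffs_strong'[where K = 1]) (use * assms in auto)
  thus "(hyp_F s has_real_derivative (\<Sum>n. diffs (hyp_coeff s) n * x ^ n)) (at x)"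
    by (simp add: hyp_F_def[abs_def])
  have "summable (\<lambda>n. diffs (hyp_coeff s) n * x ^ n)"
    by (rule termdiff_converges[where K = 1]) (use * assms in auto)
  hence "(\<lambda>n. x * (diffs (hyp_coeff s) n * x ^ n)) sums (x * (\<Sum>n. diffs (hyp_coeff s) n * x ^ n))"
    by (intro sums_mult summable_sums)
  hence "(\<lambda>n. real (Suc n) * hyp_coeff s (Suc n) * x ^ Suc n) sums (x * (\<Sum>n. diffs (hyp_coeff s) n * x ^ n))"
    by (simp add: diffs_def mult_ac)
  thus "(\<lambda>n. real n * hyp_coeff s n * x ^ n) sums (x * (\<Sum>n. diffs (hyp_coeff s) n * x ^ n))"
    by (subst (asm) sums_Suc_iff) simp
qed

lemma hyp_D_altdef:
  assumes "\<bar>x\<bar> < 1"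
  shows "hyp_D s x = x * (1 - x) * (\<Sum>n. diffs (hyp_coeff s) n * x ^ n)"
  using hyp_F_deriv(2)[OF assms] by (simp add: hyp_D_def sums_iff mult_ac)

lemma has_derivative_hyp_F:
  assumes "0 < x" "x < 1"
  shows "(hyp_F s has_real_derivative hyp_D s x / (x * (1 - x))) (at x)"
  using hyp_F_deriv(1)[of x] hyp_D_altdef[of x] assms by simp

text \<open>Multiplication by \<open>1 - x\<close> takes differences of the coefficients
  \<open>n * c_n\<close>, and by \<open>hyp_coeff_Suc\<close> the difference
  \<open>(n + 1) * c_(n+1) - n * c_n\<close> collapses to
  \<open>s * (1 - s) * c_n / (n + 1)\<close>.\<close>

lemma hyp_D_sums:
  assumes "\<bar>x\<bar> < 1"
  shows "(\<lambda>n. (if n = 0 then 0 else s * (1 - s) * hyp_coeff s (n - 1) / real n) * x ^ n) sums hyp_D s x"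
proof -
  define E where "E = (\<Sum>n. real n * hyp_coeff s n * x ^ n)"
  have 1: "(\<lambda>n. real n * hyp_coeff s n * x ^ n) sums E"
    using hyp_F_deriv(2)[OF assms] by (simp add: E_def sums_iff)
  have "(\<lambda>n. real n * hyp_coeff s n * x ^ Suc n) sums (x * E)"
    using sums_mult[OF 1, of x] by (simp add: mult_ac)
  moreover have "(\<lambda>n. real (Suc n) * hyp_coeff s (Suc n) * x ^ Suc n) sums E"
    using 1 by (subst sums_Suc_iff) auto
  ultimately have "(\<lambda>n. real (Suc n) * hyp_coeff s (Suc n) * x ^ Suc n - real n * hyp_coeff s n * x ^ Suc n)
     sums (E - x * E)"
    by (rule sums_diff[rotated])
  also have "(\<lambda>n. real (Suc n) * hyp_coeff s (Suc n) * x ^ Suc n - real n * hyp_coeff s n * x ^ Suc n) =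
    (\<lambda>n. s * (1 - s) * hyp_coeff s n / real (Suc n) * x ^ Suc n)"
  proof
    fix n
    have "real (Suc n) * hyp_coeff s (Suc n) - real n * hyp_coeff s n = s * (1 - s) * hyp_coeff s n / real (Suc n)"
      using hyp_coeff_Suc[of n s] by (simp add: field_simps power2_eq_square)
    thus "real (Suc n) * hyp_coeff s (Suc n) * x ^ Suc n - real n * hyp_coeff s n * x ^ Suc n =
      s * (1 - s) * hyp_coeff s n / real (Suc n) * x ^ Suc n"
      by (metis left_diff_distrib)
  qed
  finally have "(\<lambda>n. (\<lambda>n. (if n = 0 then 0 else s * (1 - s) * hyp_coeff s (n - 1) / real n) * x ^ n) (Suc n)) sums hyp_D s x"
    by (simp add: hyp_D_def E_def algebra_simps)
  thus ?thesis
    by (subst (asm) sums_Suc_iff) simp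
qed

text \<open>The hypergeometric equation in divergence form,
  \<open>(x (1 - x) F')' = s (1 - s) F\<close>, obtained termwise from \<open>hyp_D_sums\<close>. It
  includes \<open>x = 0\<close>, which later yields the limit of
  \<open>hyp_D s u / u\<close>.\<close>

lemma has_derivative_hyp_D:
  assumes "\<bar>x\<bar> < 1"
  shows "(hyp_D s has_real_derivative s * (1 - s) * hyp_F s x) (at x)"
proof -
  let ?d = "\<lambda>n. if n = 0 then 0 else s * (1 - s) * hyp_coeff s (n - 1) / real n"
  have x: "norm x < 1" using assms by simp
  have S: "(\<lambda>n. ?d n * y ^ n) sums hyp_D s y" if "norm y < 1" for y
    using hyp_D_sums[of y] that by simp
  have "((\<lambda>z. \<Sum>n. ?d n * z ^ n) has_real_derivative (\<Sum>n. diffs ?d n * x ^ n)) (at x)"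
    by (rule termdiffs_strong'[OF _ x]) (rule sums_summable[OF S])
  also have "(\<Sum>n. diffs ?d n * x ^ n) = (\<Sum>n. s * (1 - s) * (hyp_coeff s n * x ^ n))"
    by (rule arg_cong[where f = suminf]) (simp add: diffs_def fun_eq_iff)
  also have "\<dots> = s * (1 - s) * hyp_F s x"
    using sums_mult[OF hyp_F_sums[OF assms], of "s * (1 - s)"] by (simp add: sums_iff)
  finally have *: "((\<lambda>z. \<Sum>n. ?d n * z ^ n) has_real_derivative s * (1 - s) * hyp_F s x) (at x)" .
  show ?thesis
  proof (rule has_field_derivative_transform_within_open[OF * open_ball[of 0 1]])
    show "x \<in> ball 0 1" using assms by simp
    show "(\<Sum>n. ?d n * y ^ n) = hyp_D s y" if "y \<in> ball 0 1" for y
      using S[of y] that by (simp add: sums_iff)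
  qed
qed

lemma hyp_F_ge_1:
  assumes "0 \<le> x" "x < 1"
  shows "1 \<le> hyp_F s x"
proof -
  have "(\<lambda>n. hyp_coeff s n * x ^ n) sums hyp_F s x"
    using assms by (intro hyp_F_sums) auto
  hence "(\<Sum>n\<in>{0}. hyp_coeff s n * x ^ n) \<le> hyp_F s x"
    using hyp_coeff_bounds[OF s] assms unfolding sums_iff by (intro sum_le_suminf[THEN order.trans]) auto
  thus ?thesis by simp
qed

lemma hyp_D_0 [simp]: "hyp_D s 0 = 0"
  using hyp_D_altdef[of 0] by simp

lemma hyp_F_0 [simp]: "hyp_F s 0 = 1"
  using powser_zero[of "hyp_coeff s"] by (simp add: hyp_F_def)

lemma isCont_hyp_F: "\<bar>x\<bar> < 1 \<Longrightarrow> isCont (hyp_F s) x"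
  using hyp_F_deriv(1) by (rule DERIV_isCont)

text \<open>Gauss's product for \<open>1 / Gamma\<close> contains the Pochhammer symbols of the
  coefficients, so the limit is \<open>1 / (Gamma(s) Gamma(1 - s))\<close>, which the reflection
  formula evaluates.\<close>

lemma hyp_coeff_asymp: "(\<lambda>n. real n * hyp_coeff s n) \<longlonglongrightarrow> sin (pi * s) / pi"
proof -
  have "(\<lambda>n. rGamma_series s n * rGamma_series (1 - s) n) \<longlonglongrightarrow> rGamma s * rGamma (1 - s)"
    by (intro tendsto_intros)
  also have "rGamma s * rGamma (1 - s) = sin (pi * s) / pi"
  proof -
    have "complex_of_real (rGamma s * rGamma (1 - s)) = rGamma (complex_of_real s) * rGamma (1 - complex_of_real s)"
      by (simp add: rGamma_complex_of_real [symmetric])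
    also have "\<dots> = complex_of_real (sin (pi * s) / pi)"
      by (simp add: rGamma_reflection_complex sin_of_real [symmetric])
    finally show ?thesis
      by (subst (asm) of_real_eq_iff)
  qed
  finally have 1: "(\<lambda>n. rGamma_series s n * rGamma_series (1 - s) n) \<longlonglongrightarrow> sin (pi * s) / pi" .
  \<comment> \<open>\<open>rGamma_series\<close> pairs Pochhammer symbols of length
    \<open>n + 1\<close> with \<open>fact n\<close>. The factor \<open>n / (n + 1)\<close> corrects
    the mismatch and produces the wanted sequence at index \<open>n + 1\<close>.\<close>
  have "(\<lambda>n. (real n / real (Suc n)) * (rGamma_series s n * rGamma_series (1 - s) n)) \<longlonglongrightarrow> 1 * (sin (pi * s) / pi)"
    by (intro tendsto_mult 1 LIMSEQ_n_over_Suc_n)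
  moreover have "eventually (\<lambda>n. (real n / real (Suc n)) * (rGamma_series s n * rGamma_series (1 - s) n) =
      real (Suc n) * hyp_coeff s (Suc n)) sequentially"
    using eventually_gt_at_top[of 0]
  proof eventually_elim
    case (elim n)
    have "exp (s * ln (real n)) * exp ((1 - s) * ln (real n)) = real n"
      using elim by (simp flip: exp_add add: algebra_simps)
    moreover have "rGamma_series s n * rGamma_series (1 - s) n =
        pochhammer s (Suc n) * pochhammer (1 - s) (Suc n) /
          ((fact n)\<^sup>2 * (exp (s * ln (real n)) * exp ((1 - s) * ln (real n))))"
      by (simp add: rGamma_series_def power2_eq_square mult_ac)
    ultimately have "rGamma_series s n * rGamma_series (1 - s) n =
        pochhammer s (Suc n) * pochhammer (1 - s) (Suc n) / ((fact n)\<^sup>2 * real n)"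
      by simp
    moreover have "(fact (Suc n) :: real)\<^sup>2 = (real (Suc n))\<^sup>2 * (fact n)\<^sup>2"
      by (simp add: power_mult_distrib)
    ultimately show ?case
      using elim by (simp add: hyp_coeff_def power2_eq_square del: fact_Suc of_nat_Suc)
  qed
  ultimately have "(\<lambda>n. real (Suc n) * hyp_coeff s (Suc n)) \<longlonglongrightarrow> sin (pi * s) / pi"
    by (simp add: filterlim_cong)
  thus ?thesis by (subst (asm) filterlim_sequentially_Suc)
qed

lemma tendsto_hyp_D: "(hyp_D s \<longlongrightarrow> sin (pi * s) / pi) (at_left 1)"
  unfolding hyp_D_def[abs_def] by (rule tendsto_Abel_mean[OF hyp_coeff_asymp])

text \<open>As \<open>n * c_n\<close> has a limit, \<open>c_n\<close> tends to 0, and so does its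
  Abel mean. This control of the growth at 1 is what the limit of the Wronskian requires.\<close>

lemma tendsto_hyp_F: "((\<lambda>x. (1 - x) * hyp_F s x) \<longlongrightarrow> 0) (at_left 1)"
proof -
  have "(\<lambda>n. inverse (real n) * (real n * hyp_coeff s n)) \<longlonglongrightarrow> 0 * (sin (pi * s) / pi)"
    by (intro tendsto_mult hyp_coeff_asymp lim_inverse_n)
  hence "(\<lambda>n. inverse (real n) * (real n * hyp_coeff s n)) \<longlonglongrightarrow> 0" by simp
  moreover have "eventually (\<lambda>n. inverse (real n) * (real n * hyp_coeff s n) = hyp_coeff s n) sequentially"
    using eventually_gt_at_top[of 0] by eventually_elim simp
  ultimately have "hyp_coeff s \<longlonglongrightarrow> 0"
    by (simp add: filterlim_cong)
  thus ?thesis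
    unfolding hyp_F_def by (rule tendsto_Abel_mean)
qed

end


section \<open>Homogenised Legendre polynomials\<close>

text \<open>\<open>P\<^sub>n(w/z) z\<^sup>n\<close> as a polynomial in \<open>w\<close> and \<open>v = z\<^sup>2\<close>, so that \<open>z = 0\<close> needs no special treatment.\<close>

fun leg_hom :: "nat \<Rightarrow> real \<Rightarrow> real \<Rightarrow> real" where
  "leg_hom 0 w v = 1"
| "leg_hom (Suc 0) w v = w"
| "leg_hom (Suc (Suc n)) w v =
     ((2 * real n + 3) * w * leg_hom (Suc n) w v - (real n + 1) * v * leg_hom n w v) / (real n + 2)"

text \<open>With weight 1 for \<open>w\<close> and weight 2 for \<open>v\<close> every term of the
  recurrence is homogeneous. The rule absorbs \<open>z^n\<close> into the polynomial and later
  introduces the scaling parameter \<open>t\<close>.\<close>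

lemma leg_hom_scale: "leg_hom n (w * t) (v * t\<^sup>2) = leg_hom n w v * t ^ n"
  by (induction n w v rule: leg_hom.induct) (simp_all add: power2_eq_square algebra_simps)

text \<open>The homogenised form of \<open>P_n(1) = 1\<close>, used at the boundary
  \<open>x = 0\<close>.\<close>

lemma leg_hom_power2: "leg_hom n x (x\<^sup>2) = x ^ n"
proof (induction n x "x\<^sup>2" rule: leg_hom.induct)
  case (3 n w)
  have "(real n + 2) * leg_hom (Suc (Suc n)) w (w\<^sup>2) = (real n + 2) * w ^ Suc (Suc n)"
    using 3 by (simp add: power2_eq_square) (simp add: algebra_simps)
  thus ?case by simp
qed auto

text \<open>Induction traps the ratio of consecutive values between \<open>w\<close> and
  \<open>R\<close>. Together with \<open>w \<le> R\<close>, the last hypothesis says that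
  \<open>R\<close> is at least the larger root of \<open>X^2 - 2 w X + v\<close>, the limiting
  characteristic polynomial of the recurrence.\<close>

lemma leg_hom_bounds:
  assumes w: "0 < w" "w \<le> R" and v: "0 \<le> v" "v \<le> w\<^sup>2" and R: "0 \<le> R\<^sup>2 - 2 * w * R + v"
  shows "0 < leg_hom n w v" "leg_hom n w v \<le> R ^ n"
proof -
  have *: "0 < leg_hom n w v \<and> w * leg_hom n w v \<le> leg_hom (Suc n) w v \<and> leg_hom (Suc n) w v \<le> R * leg_hom n w v" for n
  proof (induction n)
    case (Suc n)
    define a where "a = leg_hom n w v"
    define b where "b = leg_hom (Suc n) w v"
    define c where "c = leg_hom (Suc (Suc n)) w v"
    have IH: "0 < a" "w * a \<le> b" "b \<le> R * a" using Suc by (auto simp: a_def b_def)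
    have "0 < w * a" using IH w by simp
    hence b: "0 < b" using IH by linarith
    have rec: "(real n + 2) * c = (2 * real n + 3) * (w * b) - (real n + 1) * (v * a)"
      by (simp add: a_def b_def c_def)
    have "v * a \<le> w\<^sup>2 * a" using v IH by (intro mult_right_mono) auto
    also have "\<dots> \<le> w * b" using mult_left_mono[OF IH(2), of w] w by (simp add: power2_eq_square mult_ac)
    finally have "(real n + 1) * (v * a) \<le> (real n + 1) * (w * b)"
      by (intro mult_left_mono) auto
    hence "(real n + 2) * (w * b) \<le> (real n + 2) * c"
      unfolding rec by (simp add: algebra_simps)
    hence lower: "w * b \<le> c" by simp
    \<comment> \<open>The hypothesis on \<open>R\<close> and the bound \<open>b \<le> R * a\<close>
      give a lower bound for the subtracted term \<open>v * a\<close> of the recurrence.\<close>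
    have "(2 * w * R - R\<^sup>2) * b \<le> v * b" using R b by (intro mult_right_mono) auto
    also have "\<dots> \<le> R * (v * a)" using mult_left_mono[OF IH(3), of v] v by (simp add: mult_ac)
    finally have "(real n + 1) * ((2 * w * R - R\<^sup>2) * b) \<le> (real n + 1) * (R * (v * a))"
      by (intro mult_left_mono) auto
    moreover have "R * (w * b) \<le> R * (R * b)"
      using w b by (intro mult_left_mono mult_right_mono) auto
    ultimately have "R * ((real n + 2) * c) \<le> R * ((real n + 2) * (R * b))"
      unfolding rec by (simp add: algebra_simps power2_eq_square)
    hence "c \<le> R * b" using w by simp
    thus ?case using lower b by (simp add: b_def c_def)
  qed (use w in auto)
  show "0 < leg_hom n w v" using * by blast
  show "leg_hom n w v \<le> R ^ n"
  proof (induction n)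
    case (Suc n)
    have "leg_hom (Suc n) w v \<le> R * leg_hom n w v" using * by blast
    also have "\<dots> \<le> R * R ^ n" using Suc w by (intro mult_left_mono) auto
    finally show ?case by simp
  qed auto
qed

text \<open>With \<open>w = x + y - 2 x y\<close> and \<open>z = y - x\<close> this is
  \<open>P_n(w/z) z^n\<close>. In these variables the radicand \<open>1 - 2 w + z^2\<close> of the
  Legendre generating function is the square of \<open>1 - x - y\<close>, and Brafman's series
  separates.\<close>

definition leg_sep :: "nat \<Rightarrow> real \<Rightarrow> real \<Rightarrow> real" where
  "leg_sep n x y = leg_hom n (x + y - 2 * x * y) ((y - x)\<^sup>2)"

lemma leg_sep_0 [simp]: "leg_sep 0 x y = 1"
  and leg_sep_1 [simp]: "leg_sep (Suc 0) x y = x + y - 2 * x * y"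
  and leg_sep_rec: "leg_sep (Suc (Suc n)) x y = ((2 * real n + 3) * (x + y - 2 * x * y) * leg_sep (Suc n) x y
     - (real n + 1) * (y - x)\<^sup>2 * leg_sep n x y) / (real n + 2)"
  by (simp_all add: leg_sep_def)

lemma leg_sep_0_left [simp]: "leg_sep n 0 y = y ^ n"
  by (simp add: leg_sep_def leg_hom_power2)

text \<open>\<open>x (1 - x) \<partial>\<^sub>x Q\<^sub>n(x, y)\<close> without a division.\<close>

definition leg_flux :: "nat \<Rightarrow> real \<Rightarrow> real \<Rightarrow> real" where
  "leg_flux n x y = real n / 2 * ((1 - 2 * x) * leg_sep n x y - (y - x) * leg_sep (n - 1) x y)"

lemma leg_flux_twice:
  "2 * leg_flux n x y = real n * ((1 - 2 * x) * leg_sep n x y - (y - x) * leg_sep (n - 1) x y)"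
  by (simp add: leg_flux_def)

lemma leg_flux_0_left [simp]: "leg_flux n 0 y = 0"
  by (cases n) (auto simp: leg_flux_def)

text \<open>The classical rule \<open>(X^2 - 1) P_n' = n (X P_n - P_(n-1))\<close>, carried over to
  \<open>x\<close> and \<open>y\<close>. The induction carries two consecutive indices because
  differentiating the recurrence needs both.\<close>

lemma has_derivative_leg_sep:
  assumes "0 < x" "x < 1"
  shows "((\<lambda>x. leg_sep n x y) has_real_derivative leg_flux n x y / (x * (1 - x))) (at x)"
proof -
  have nz: "x \<noteq> 0" "1 - x \<noteq> 0" using assms by auto
  have "((\<lambda>x. leg_sep n x y) has_real_derivative leg_flux n x y / (x * (1 - x))) (at x) \<and>
        ((\<lambda>x. leg_sep (Suc n) x y) has_real_derivative leg_flux (Suc n) x y / (x * (1 - x))) (at x)"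
  proof (induction n)
    case 0
    have "((\<lambda>x. x + y - 2 * x * y) has_real_derivative 1 - 2 * y) (at x)"
      by (auto intro!: derivative_eq_intros)
    moreover have "1 - 2 * y = leg_flux (Suc 0) x y / (x * (1 - x))"
      using nz by (simp add: leg_flux_def divide_simps) (simp add: algebra_simps power2_eq_square)
    ultimately show ?case by (simp add: leg_flux_def)
  next
    case (Suc n)
    let ?A = "leg_sep n x y" and ?B = "leg_sep (Suc n) x y"
    let ?A' = "leg_flux n x y / (x * (1 - x))" and ?B' = "leg_flux (Suc n) x y / (x * (1 - x))"
    have "((\<lambda>x. (2 * real n + 3) * (x + y - 2 * x * y) * leg_sep (Suc n) x y
        - (real n + 1) * (y - x)\<^sup>2 * leg_sep n x y) has_real_derivative
       (2 * real n + 3) * ((1 - 2 * y) * ?B + (x + y - 2 * x * y) * B')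
         - (real n + 1) * (- 2 * (y - x) * ?A + (y - x)\<^sup>2 * A')) (at x)"
      if "((\<lambda>x. leg_sep n x y) has_real_derivative A') (at x)"
         "((\<lambda>x. leg_sep (Suc n) x y) has_real_derivative B') (at x)" for A' B'
      using that by (auto intro!: derivative_eq_intros simp: algebra_simps)
    note DERIV_cdivide[OF this[OF Suc[THEN conjunct1] Suc[THEN conjunct2]], of "real n + 2"]
    hence "((\<lambda>x. leg_sep (Suc (Suc n)) x y) has_real_derivative
       ((2 * real n + 3) * ((1 - 2 * y) * ?B + (x + y - 2 * x * y) * ?B')
         - (real n + 1) * (- 2 * (y - x) * ?A + (y - x)\<^sup>2 * ?A')) / (real n + 2)) (at x)"
      unfolding leg_sep_rec .
    also have "((2 * real n + 3) * ((1 - 2 * y) * ?B + (x + y - 2 * x * y) * ?B')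
         - (real n + 1) * (- 2 * (y - x) * ?A + (y - x)\<^sup>2 * ?A')) / (real n + 2)
         = leg_flux (Suc (Suc n)) x y / (x * (1 - x))"
    \<comment> \<open>\<open>leg_flux n\<close> refers to index \<open>n - 1\<close>, so the generic
      computation needs \<open>n = Suc m\<close>.\<close>
    proof (cases n)
      case 0
      show ?thesis unfolding 0
        using nz by (simp add: leg_flux_def leg_sep_rec divide_simps) (simp add: algebra_simps power2_eq_square)
    next
      case [simp]: (Suc m)
      define a where "a = leg_sep m x y"
      define b where "b = leg_sep (Suc m) x y"
      define c where "c = leg_sep (Suc (Suc m)) x y"
      have rec: "(real m + 1) * (y - x)\<^sup>2 * a = (2 * real m + 3) * (x + y - 2 * x * y) * b - (real m + 2) * c"
        by (simp add: a_def b_def c_def leg_sep_rec)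
      have d: "leg_sep (Suc (Suc (Suc m))) x y = ((2 * real m + 5) * (x + y - 2 * x * y) * c - (real m + 2) * (y - x)\<^sup>2 * b) / (real m + 3)"
        by (simp add: b_def c_def leg_sep_rec[of "Suc m"] algebra_simps)
      have fA: "2 * leg_flux n x y = (real m + 1) * ((1 - 2 * x) * b - (y - x) * a)"
        and fB: "2 * leg_flux (Suc n) x y = (real m + 2) * ((1 - 2 * x) * c - (y - x) * b)"
        and fC: "2 * leg_flux (Suc (Suc n)) x y = (real m + 3) * ((1 - 2 * x) * leg_sep (Suc (Suc (Suc m))) x y - (y - x) * c)"
        by (simp_all add: leg_flux_twice a_def b_def c_def algebra_simps)
      \<comment> \<open>After multiplication by \<open>(y - x)^2\<close>, \<open>a\<close> occurs
        only in the combination that the recurrence eliminates. Nothing is divided by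
        \<open>y - x\<close>, which may be 0.\<close>
      have "(y - x)\<^sup>2 * (2 * leg_flux n x y) =
          (real m + 1) * (1 - 2 * x) * (y - x)\<^sup>2 * b - (y - x) * ((real m + 1) * (y - x)\<^sup>2 * a)"
        unfolding fA by (simp add: algebra_simps)
      also note rec
      finally have 1: "(y - x)\<^sup>2 * (2 * leg_flux n x y) = (real m + 1) * (1 - 2 * x) * (y - x)\<^sup>2 * b
          - (y - x) * ((2 * real m + 3) * (x + y - 2 * x * y) * b - (real m + 2) * c)" .
      have 2: "2 * leg_flux (Suc (Suc n)) x y = (1 - 2 * x) * ((2 * real m + 5) * (x + y - 2 * x * y) * c - (real m + 2) * (y - x)\<^sup>2 * b) - (real m + 3) * (y - x) * c"
        unfolding fC d by (simp add: field_simps)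
      have key: "(2 * real m + 5) * (2 * (x * (1 - x)) * (1 - 2 * y) * c + (x + y - 2 * x * y) * (2 * leg_flux (Suc n) x y))
         - (real m + 2) * (- 4 * (x * (1 - x)) * (y - x) * b + (y - x)\<^sup>2 * (2 * leg_flux n x y))
         = (real m + 3) * (2 * leg_flux (Suc (Suc n)) x y)"
        unfolding 1 2 fB by (simp add: algebra_simps power2_eq_square)
      define p where "p = x * (1 - x)"
      have p: "p \<noteq> 0" using nz by (simp add: p_def)
      define A' where "A' = leg_flux n x y / p"
      define B' where "B' = leg_flux (Suc n) x y / p"
      define C' where "C' = leg_flux (Suc (Suc n)) x y / p"
      have "leg_flux n x y = p * A'" "leg_flux (Suc n) x y = p * B'" "leg_flux (Suc (Suc n)) x y = p * C'"
        using p by (simp_all add: A'_def B'_def C'_def)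
      with key have "(2 * p) * ((2 * real m + 5) * ((1 - 2 * y) * c + (x + y - 2 * x * y) * B')
         - (real m + 2) * (- 2 * (y - x) * b + (y - x)\<^sup>2 * A')) = (2 * p) * ((real m + 3) * C')"
        unfolding p_def[symmetric] by (simp add: algebra_simps)
      hence "(2 * real m + 5) * ((1 - 2 * y) * c + (x + y - 2 * x * y) * B')
         - (real m + 2) * (- 2 * (y - x) * b + (y - x)\<^sup>2 * A') = (real m + 3) * C'"
        using p by (subst (asm) mult_cancel_left) auto
      hence "((2 * real m + 5) * ((1 - 2 * y) * c + (x + y - 2 * x * y) * B')
         - (real m + 2) * (- 2 * (y - x) * b + (y - x)\<^sup>2 * A')) / (real m + 3) = C'"
        by (simp add: field_simps)
      thus ?thesis
        by (simp add: b_def c_def A'_def B'_def C'_def p_def add_ac)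
    qed
    finally show ?case using Suc by blast
  qed
  thus ?thesis by blast
qed

text \<open>Legendre's equation in the form \<open>L Q_n = n^2 Q_(n-1) - n (n + 1) Q_n\<close>: the
  flux is differentiated by \<open>has_derivative_leg_sep\<close> and \<open>Q_(n-2)\<close> is
  removed by the recurrence. The neighbour \<open>Q_(n-1)\<close> is what telescopes against
  \<open>hyp_coeff_Suc\<close>.\<close>

lemma has_derivative_leg_flux:
  assumes "0 < x" "x < 1"
  shows "((\<lambda>x. leg_flux n x y) has_real_derivative
           (real n)\<^sup>2 * leg_sep (n - 1) x y - real n * (real n + 1) * leg_sep n x y) (at x)"
proof -
  have nz: "x \<noteq> 0" "1 - x \<noteq> 0" using assms by auto
  define p where "p = x * (1 - x)"
  have p: "p \<noteq> 0" using nz by (simp add: p_def)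
  have "((\<lambda>x. real n / 2 * ((1 - 2 * x) * leg_sep n x y - (y - x) * leg_sep (n - 1) x y)) has_real_derivative
      real n / 2 * (- 2 * leg_sep n x y + (1 - 2 * x) * A' - (- leg_sep (n - 1) x y + (y - x) * B'))) (at x)"
    if "((\<lambda>x. leg_sep n x y) has_real_derivative A') (at x)"
       "((\<lambda>x. leg_sep (n - 1) x y) has_real_derivative B') (at x)" for A' B'
    using that by (auto intro!: derivative_eq_intros simp: algebra_simps)
  from this[OF has_derivative_leg_sep[OF assms] has_derivative_leg_sep[OF assms]]
  have "((\<lambda>x. leg_flux n x y) has_real_derivative
      real n / 2 * (- 2 * leg_sep n x y + (1 - 2 * x) * (leg_flux n x y / p)
        - (- leg_sep (n - 1) x y + (y - x) * (leg_flux (n - 1) x y / p)))) (at x)"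
    by (simp only: leg_flux_def[of n, abs_def] p_def)
  also have "real n / 2 * (- 2 * leg_sep n x y + (1 - 2 * x) * (leg_flux n x y / p)
        - (- leg_sep (n - 1) x y + (y - x) * (leg_flux (n - 1) x y / p)))
      = (real n)\<^sup>2 * leg_sep (n - 1) x y - real n * (real n + 1) * leg_sep n x y"
  proof -
    \<comment> \<open>The flux at \<open>n - 1\<close> refers to index \<open>n - 2\<close>, so 0
      and 1 are treated apart.\<close>
    consider "n = 0" | "n = 1" | m where "n = Suc (Suc m)"
      by (metis One_nat_def not0_implies_Suc)
    thus ?thesis
    proof cases
      case 2
      thus ?thesis using nz unfolding p_def
        by (simp add: leg_flux_def divide_simps) (simp add: algebra_simps power2_eq_square)
    next
      case [simp]: 3
      define a where "a = leg_sep m x y"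
      define b where "b = leg_sep (Suc m) x y"
      define c where "c = leg_sep (Suc (Suc m)) x y"
      have rec: "(real m + 1) * (y - x)\<^sup>2 * a = (2 * real m + 3) * (x + y - 2 * x * y) * b - (real m + 2) * c"
        by (simp add: a_def b_def c_def leg_sep_rec)
      have fB: "2 * leg_flux (n - 1) x y = (real m + 1) * ((1 - 2 * x) * b - (y - x) * a)"
        and fC: "2 * leg_flux n x y = (real m + 2) * ((1 - 2 * x) * c - (y - x) * b)"
        by (simp_all add: leg_flux_twice a_def b_def c_def algebra_simps)
      have "(y - x) * (2 * leg_flux (n - 1) x y) = (real m + 1) * (1 - 2 * x) * (y - x) * b - (real m + 1) * (y - x)\<^sup>2 * a"
        unfolding fB by (simp add: algebra_simps power2_eq_square)
      also note rec
      finally have 1: "(y - x) * (2 * leg_flux (n - 1) x y) = (real m + 1) * (1 - 2 * x) * (y - x) * b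
         - ((2 * real m + 3) * (x + y - 2 * x * y) * b - (real m + 2) * c)" .
      have key: "- 2 * (2 * (x * (1 - x))) * c + (1 - 2 * x) * (2 * leg_flux n x y) + 2 * (x * (1 - x)) * b - (y - x) * (2 * leg_flux (n - 1) x y)
         = 2 * (2 * (x * (1 - x))) * (real m + 2) * b - 2 * (2 * (x * (1 - x))) * (real m + 3) * c"
        unfolding 1 fC by (simp add: algebra_simps power2_eq_square)
      have "- 2 * c + (1 - 2 * x) * (leg_flux n x y / p) - (- b + (y - x) * (leg_flux (n - 1) x y / p))
         = 2 * (real m + 2) * b - 2 * (real m + 3) * c"
      proof -
        define B' where "B' = leg_flux (n - 1) x y / p"
        define C' where "C' = leg_flux n x y / p"
        have "leg_flux (n - 1) x y = p * B'" "leg_flux n x y = p * C'"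
          using p by (simp_all add: B'_def C'_def)
        with key have "(2 * p) * (- 2 * c + (1 - 2 * x) * C' - (- b + (y - x) * B'))
          = (2 * p) * (2 * (real m + 2) * b - 2 * (real m + 3) * c)"
          unfolding p_def[symmetric] by (simp add: algebra_simps)
        thus ?thesis
          using p unfolding B'_def C'_def by (subst (asm) mult_cancel_left) auto
      qed
      hence *: "- 2 * leg_sep n x y + (1 - 2 * x) * (leg_flux n x y / p)
        - (- leg_sep (n - 1) x y + (y - x) * (leg_flux (n - 1) x y / p)) = 2 * (real m + 2) * b - 2 * (real m + 3) * c"
        by (simp add: b_def c_def)
      thus ?thesis
        unfolding *
        by (simp add: b_def c_def power2_eq_square field_simps)
    qed auto
  qed
  finally show ?thesis .
qed

text \<open>Bonnet's three-term recurrence, which defines \<open>leg_hom\<close>, is verified on the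
  coefficients of the hypergeometric polynomial in \<open>(1 - x) / 2\<close>.\<close>

lemma legendre_P_eq_leg_hom: "legendre_P n x = leg_hom n x 1"
proof -
  define a where "a = (\<lambda>n j. pochhammer (- real n) j * pochhammer (real n + 1) j / (fact j :: real)\<^sup>2)"
  have a_0: "a n 0 = 1" for n by (simp add: a_def)
  have a_gt: "a n j = 0" if "j > n" for n j
    using that by (simp add: a_def pochhammer_of_nat_eq_0_iff)
  \<comment> \<open>Bonnet's recurrence at the power \<open>Suc m\<close> of
    \<open>y = (1 - x) / 2\<close>: since \<open>x = 1 - 2 * y\<close>, multiplication by
    \<open>x\<close> brings in the coefficient at \<open>m\<close>.\<close>
  have a_rec: "(real n + 2) * a (Suc (Suc n)) (Suc m) + (real n + 1) * a n (Suc m) =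
      (2 * real n + 3) * (a (Suc n) (Suc m) - 2 * a (Suc n) m)" for n m
  proof -
    \<comment> \<open>\<open>M\<close> and \<open>K\<close> are common to all Pochhammer products
      below; taking them out leaves a polynomial identity in \<open>n\<close> and
      \<open>m\<close>.\<close>
    define M where "M = pochhammer (- real n - 1) m"
    define K where "K = pochhammer (real n + 2) m"
    have f: "(fact (Suc m) :: real)\<^sup>2 = (real m + 1)\<^sup>2 * (fact m)\<^sup>2"
      by (simp add: power_mult_distrib add.commute)
    have K': "(real n + 2) * pochhammer (real n + 3) m = (real n + 2 + real m) * K"
      using pochhammer_rec[of "real n + 2" m] pochhammer_rec'[of "real n + 2" m]
      by (simp add: K_def algebra_simps)
    have M': "(- real n - 1) * pochhammer (- real n) m = (real m - real n - 1) * M"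
      using pochhammer_rec[of "- real n - 1" m] pochhammer_rec'[of "- real n - 1" m]
      by (simp add: M_def algebra_simps)
    have "pochhammer (- real n - 2) (Suc m) = (- real n - 2) * M"
    proof -
      have "(- real n - 2) + 1 = - real n - 1" by simp
      thus ?thesis unfolding M_def pochhammer_rec by (simp only:)
    qed
    moreover have "pochhammer (real n + 3) (Suc m) = pochhammer (real n + 3) m * (real n + 3 + real m)"
      by (simp add: pochhammer_Suc)
    ultimately have "pochhammer (- real n - 2) (Suc m) * pochhammer (real n + 3) (Suc m) =
      - M * (real n + 3 + real m) * ((real n + 2) * pochhammer (real n + 3) m)"
      by (simp only:) (simp add: algebra_simps)
    hence A2: "pochhammer (- real n - 2) (Suc m) * pochhammer (real n + 3) (Suc m) =
      - M * (real n + 3 + real m) * ((real n + 2 + real m) * K)"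
      unfolding K' .
    have "pochhammer (- real n) (Suc m) = pochhammer (- real n) m * (real m - real n)"
      by (simp add: pochhammer_Suc)
    moreover have "pochhammer (real n + 1) (Suc m) = (real n + 1) * K"
      using pochhammer_rec[of "real n + 1" m] by (simp add: K_def algebra_simps)
    ultimately have "pochhammer (- real n) (Suc m) * pochhammer (real n + 1) (Suc m) =
       - K * (real m - real n) * ((- real n - 1) * pochhammer (- real n) m)"
      by (simp only:) (simp add: algebra_simps)
    hence A0: "pochhammer (- real n) (Suc m) * pochhammer (real n + 1) (Suc m) =
       - K * (real m - real n) * ((real m - real n - 1) * M)"
      unfolding M' .
    have A1: "pochhammer (- real n - 1) (Suc m) * pochhammer (real n + 2) (Suc m) =
       M * K * (real m - real n - 1) * (real n + 2 + real m)"
      by (simp add: pochhammer_Suc M_def K_def)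
    have r: "- real (Suc n) = - real n - 1" "real (Suc n) + 1 = real n + 2"
      "- real (Suc (Suc n)) = - real n - 2" "real (Suc (Suc n)) + 1 = real n + 3"
      by simp_all
    have e: "a (Suc (Suc n)) (Suc m) = - M * (real n + 3 + real m) * ((real n + 2 + real m) * K) / ((real m + 1)\<^sup>2 * (fact m)\<^sup>2)"
      "a n (Suc m) = - K * (real m - real n) * ((real m - real n - 1) * M) / ((real m + 1)\<^sup>2 * (fact m)\<^sup>2)"
      "a (Suc n) (Suc m) = M * K * (real m - real n - 1) * (real n + 2 + real m) / ((real m + 1)\<^sup>2 * (fact m)\<^sup>2)"
      "a (Suc n) m = M * K * (real m + 1)\<^sup>2 / ((real m + 1)\<^sup>2 * (fact m)\<^sup>2)"
      using add.commute[of 1 "real m"]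
      by (simp_all only: A2[symmetric] A1[symmetric] A0[symmetric] f[symmetric] a_def r)
         (simp add: f M_def K_def del: fact_Suc)
    have "(real n + 2) * (- M * (real n + 3 + real m) * ((real n + 2 + real m) * K)) +
       (real n + 1) * (- K * (real m - real n) * ((real m - real n - 1) * M)) =
       (2 * real n + 3) * (M * K * (real m - real n - 1) * (real n + 2 + real m) - 2 * (M * K * (real m + 1)\<^sup>2))"
      by (simp add: algebra_simps power2_eq_square)
    thus ?thesis
      unfolding e by (simp only: times_divide_eq_right add_divide_distrib[symmetric] diff_divide_distrib[symmetric])
  qed
  define y where "y = (1 - x) / 2"
  have P: "legendre_P n x = (\<Sum>j\<le>N. a n j * y ^ j)" if "n \<le> N" for n N
  proof -
    have "legendre_P n x = (\<Sum>j\<le>n. a n j * y ^ j)"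
      by (simp add: legendre_P_altdef a_def y_def)
    also have "\<dots> = (\<Sum>j\<le>N. a n j * y ^ j)"
      using that by (intro sum.mono_neutral_left) (auto simp: a_gt)
    finally show ?thesis .
  qed
  have rec: "(real n + 2) * legendre_P (Suc (Suc n)) x =
      (2 * real n + 3) * x * legendre_P (Suc n) x - (real n + 1) * legendre_P n x" for n
  proof -
    let ?N = "Suc n"
    \<comment> \<open>All three sums are padded to one upper limit to be compared term by term. The
      constant terms, split off here, match because
      \<open>(n + 2) + (n + 1) = 2 n + 3\<close>.\<close>
    have shift: "legendre_P i x = 1 + (\<Sum>j\<le>?N. a i (Suc j) * y ^ Suc j)" if "i \<le> Suc ?N" for i
      unfolding P[OF that] by (subst sum.atMost_Suc_shift) (simp add: a_0)
    have "(\<Sum>j\<le>?N. ((real n + 2) * a (Suc (Suc n)) (Suc j) + (real n + 1) * a n (Suc j)) * y ^ Suc j) =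
      (real n + 2) * (\<Sum>j\<le>?N. a (Suc (Suc n)) (Suc j) * y ^ Suc j) + (real n + 1) * (\<Sum>j\<le>?N. a n (Suc j) * y ^ Suc j)"
      by (simp only: distrib_right sum.distrib sum_distrib_left mult.assoc)
    hence "(real n + 2) * legendre_P (Suc (Suc n)) x + (real n + 1) * legendre_P n x =
       (2 * real n + 3) + (\<Sum>j\<le>?N. ((real n + 2) * a (Suc (Suc n)) (Suc j) + (real n + 1) * a n (Suc j)) * y ^ Suc j)"
      using shift[of n] shift[of "Suc (Suc n)"] by (simp add: algebra_simps del: sum.atMost_Suc power_Suc)
    also have "(\<Sum>j\<le>?N. ((real n + 2) * a (Suc (Suc n)) (Suc j) + (real n + 1) * a n (Suc j)) * y ^ Suc j) =
       (\<Sum>j\<le>?N. (2 * real n + 3) * (a (Suc n) (Suc j) * y ^ Suc j - 2 * y * (a (Suc n) j * y ^ j)))"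
      unfolding a_rec by (intro sum.cong) (simp_all add: algebra_simps)
    also have "\<dots> = (2 * real n + 3) * ((\<Sum>j\<le>?N. a (Suc n) (Suc j) * y ^ Suc j) - 2 * y * (\<Sum>j\<le>?N. a (Suc n) j * y ^ j))"
      by (simp only: sum_distrib_left[symmetric] sum_subtractf)
    also have "(\<Sum>j\<le>?N. a (Suc n) j * y ^ j) = legendre_P (Suc n) x"
      by (rule P[symmetric]) simp
    also have "(\<Sum>j\<le>?N. a (Suc n) (Suc j) * y ^ Suc j) = legendre_P (Suc n) x - 1"
      using shift[of "Suc n"] by simp
    finally show ?thesis
      by (simp add: y_def field_simps)
  qed
  have "legendre_P n x = leg_hom n x 1 \<and> legendre_P (Suc n) x = leg_hom (Suc n) x 1"
  proof (induction n)
    case 0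
    show ?case by (simp add: legendre_P_altdef) (simp add: field_simps)
  next
    case (Suc n)
    hence "(real n + 2) * legendre_P (Suc (Suc n)) x = (real n + 2) * leg_hom (Suc (Suc n)) x 1"
      unfolding rec by simp
    thus ?case using Suc by (simp add: eq_divide_eq mult_ac)
  qed
  thus ?thesis by blast
qed


section \<open>Brafman's formula\<close>

text \<open>With \<open>r = 1 - x - y\<close>, the identity \<open>1 - 2 w + z^2 = r^2\<close> and
  \<open>z^2 \<le> 1\<close> give \<open>w \<le> R\<close> for \<open>R = 1 - r^2 / 2\<close>.
  Moreover \<open>R^2 - 2 w R + z^2 = r^2 w + r^4 / 4\<close> is nonnegative, so
  \<open>leg_hom_bounds\<close> applies with this explicit rate below 1.\<close>

lemma leg_sep_bounds:
  assumes "0 \<le> x" "0 < y" "x + y < 1"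
  shows "0 \<le> leg_sep n x y" "leg_sep n x y \<le> (1 - (1 - x - y)\<^sup>2 / 2) ^ n"
proof -
  define w where "w = x + y - 2 * x * y"
  define r where "r = 1 - x - y"
  define R where "R = 1 - r\<^sup>2 / 2"
  have r: "0 < r" "r \<le> 1" using assms by (auto simp: r_def)
  have "w = x * (1 - y) + y * (1 - x)" by (simp add: w_def algebra_simps)
  moreover have "0 < y * (1 - x)" "0 \<le> x * (1 - y)" using assms by auto
  ultimately have w0: "0 < w" by linarith
  have wz: "1 - 2 * w + (y - x)\<^sup>2 = r\<^sup>2"
    by (simp add: w_def r_def power2_eq_square algebra_simps)
  have z1: "(y - x)\<^sup>2 \<le> 1"
    using assms by (simp add: abs_square_le_1)
  have "0 \<le> x * (1 - x) * (y * (1 - y))" using assms by auto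
  moreover have "w\<^sup>2 - (y - x)\<^sup>2 = 4 * (x * (1 - x) * (y * (1 - y)))"
    by (simp add: w_def power2_eq_square algebra_simps)
  ultimately have v: "(y - x)\<^sup>2 \<le> w\<^sup>2" by linarith
  have wR: "w \<le> R" using wz z1 by (simp add: R_def)
  have "R\<^sup>2 - 2 * w * R + (y - x)\<^sup>2 = (1 - 2 * w + (y - x)\<^sup>2) - r\<^sup>2 * (1 - w) + (r\<^sup>2 / 2)\<^sup>2"
    by (simp add: R_def power2_eq_square algebra_simps)
  also have "\<dots> = r\<^sup>2 * w + (r\<^sup>2 / 2)\<^sup>2"
    unfolding wz by (simp add: algebra_simps)
  finally have "0 \<le> R\<^sup>2 - 2 * w * R + (y - x)\<^sup>2" using w0 by simp
  from leg_hom_bounds[OF w0 wR _ v this, of n]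
  show "0 \<le> leg_sep n x y" "leg_sep n x y \<le> (1 - (1 - x - y)\<^sup>2 / 2) ^ n"
    by (simp_all add: leg_sep_def w_def R_def r_def)
qed

lemma continuous_on_leg_hom [continuous_intros]:
  assumes "continuous_on A f" "continuous_on A g"
  shows "continuous_on A (\<lambda>u. leg_hom n (f u) (g u))"
proof (induction n rule: induct_nat_012)
  case (ge2 n)
  have "continuous_on A (\<lambda>u. ((2 * real n + 3) * f u * leg_hom (Suc n) (f u) (g u)
     - (real n + 1) * g u * leg_hom n (f u) (g u)) / (real n + 2))"
    using ge2 assms by (intro continuous_intros) auto
  thus ?case by simp
qed (use assms in auto)

text \<open>
  The Wronskian of the partial sums and \<open>F\<close> in the variable \<open>x\<close> has a derivative consisting of a
  single term, which tends to \<open>0\<close> uniformly. So the partial sums become proportional to \<open>F\<close>.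
\<close>

lemma brafman:
  assumes s: "0 < s" "s < 1" and xy: "0 < x" "0 < y" "x + y < 1"
  shows "(\<lambda>n. hyp_coeff s n * leg_sep n x y) sums (hyp_F s x * hyp_F s y)"
proof -
  define S where "S = (\<lambda>N u. \<Sum>n<N. hyp_coeff s n * leg_sep n u y)"
  define T where "T = (\<lambda>N u. \<Sum>n<N. hyp_coeff s n * leg_flux n u y)"
  define V where "V = (\<lambda>N u. T N u * hyp_F s u - S N u * hyp_D s u)"
  define R where "R = 1 - (1 - x - y)\<^sup>2 / 2"
  obtain B where B: "\<And>u. u \<in> {0..x} \<Longrightarrow> hyp_F s u \<le> B"
  proof -
    have "continuous_on {0..x} (hyp_F s)"
      using xy by (intro continuous_at_imp_continuous_on ballI isCont_hyp_F[OF s]) auto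
    hence "compact (hyp_F s ` {0..x})" by (intro compact_continuous_image) auto
    hence "bdd_above (hyp_F s ` {0..x})"
      by (intro bounded_imp_bdd_above compact_imp_bounded)
    then obtain M where "\<forall>u\<in>{0..x}. hyp_F s u \<le> M" by (auto simp: bdd_above_def)
    thus ?thesis using that by blast
  qed
  \<comment> \<open>Bounds the derivative of \<open>V N\<close> on \<open>{0<..<x}\<close>: the
    coefficient is at most 1, \<open>leg_sep\<close> at most \<open>R ^ (N - 1)\<close> and
    \<open>hyp_F\<close> at most \<open>B\<close>.\<close>
  define \<epsilon> where "\<epsilon> = (\<lambda>N. (real N)\<^sup>2 * R ^ (N - 1) * B)"
  have "0 < (1 - x - y)\<^sup>2" "(1 - x - y)\<^sup>2 \<le> 1"
    using xy by (auto simp: abs_square_le_1)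
  hence R: "0 < R" "R < 1"
    by (auto simp: R_def)
  have F1: "1 \<le> hyp_F s u" if "u \<in> {0..x}" for u
    using that xy by (intro hyp_F_ge_1[OF s]) auto
  \<comment> \<open>By \<open>hyp_coeff_Suc\<close> the multiple of \<open>Q_n\<close> from index
    \<open>n\<close>, eigenvalue included, cancels the one from index \<open>n + 1\<close>; only the
    top index leaves a remainder.\<close>
  have dT_eq: "(\<Sum>n<N. hyp_coeff s n * ((real n)\<^sup>2 * leg_sep (n - 1) u y - real n * (real n + 1) * leg_sep n u y)) -
      s * (1 - s) * S N u = - ((real N)\<^sup>2 * hyp_coeff s N * leg_sep (N - 1) u y)" for N u
  proof (induction N)
    case (Suc N)
    have "(real (Suc N))\<^sup>2 * hyp_coeff s (Suc N) * leg_sep N u y =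
        (real N * (real N + 1) + s * (1 - s)) * hyp_coeff s N * leg_sep N u y"
      using hyp_coeff_Suc[of N s] by (simp add: add.commute)
    with Suc show ?case by (simp add: S_def algebra_simps)
  qed (simp add: S_def)
  have deriv_S: "(S N has_real_derivative T N u / (u * (1 - u))) (at u)" if "u \<in> {0<..<1}" for N u
    unfolding S_def T_def sum_divide_distrib times_divide_eq_right [symmetric] using that
    by (intro DERIV_sum DERIV_cmult has_derivative_leg_sep) auto
  have deriv_T: "(T N has_real_derivative
      (\<Sum>n<N. hyp_coeff s n * ((real n)\<^sup>2 * leg_sep (n - 1) u y - real n * (real n + 1) * leg_sep n u y))) (at u)"
    if "u \<in> {0<..<1}" for N u
    unfolding T_def using that by (intro DERIV_sum DERIV_cmult has_derivative_leg_flux) auto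
  have deriv_V: "(V N has_real_derivative - ((real N)\<^sup>2 * hyp_coeff s N * leg_sep (N - 1) u y) * hyp_F s u) (at u)"
    if u: "u \<in> {0<..<1}" for N u
  proof -
    have "(V N has_real_derivative
      (\<Sum>n<N. hyp_coeff s n * ((real n)\<^sup>2 * leg_sep (n - 1) u y - real n * (real n + 1) * leg_sep n u y)) * hyp_F s u
      + hyp_D s u / (u * (1 - u)) * T N u
      - (T N u / (u * (1 - u)) * hyp_D s u + s * (1 - s) * hyp_F s u * S N u)) (at u)"
      unfolding V_def using u
      by (intro DERIV_diff DERIV_mult deriv_S deriv_T has_derivative_hyp_F[OF s] has_derivative_hyp_D[OF s]) auto
    also have "(\<Sum>n<N. hyp_coeff s n * ((real n)\<^sup>2 * leg_sep (n - 1) u y - real n * (real n + 1) * leg_sep n u y)) * hyp_F s u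
      + hyp_D s u / (u * (1 - u)) * T N u
      - (T N u / (u * (1 - u)) * hyp_D s u + s * (1 - s) * hyp_F s u * S N u) =
      ((\<Sum>n<N. hyp_coeff s n * ((real n)\<^sup>2 * leg_sep (n - 1) u y - real n * (real n + 1) * leg_sep n u y)) - s * (1 - s) * S N u) * hyp_F s u"
      by (simp add: algebra_simps)
    finally show ?thesis unfolding dT_eq .
  qed
  have cont_leg: "continuous_on A (\<lambda>u. leg_sep n u y)" for A n
    unfolding leg_sep_def by (intro continuous_intros)
  have cont_S: "continuous_on A (S N)" for A N
    unfolding S_def by (intro continuous_intros cont_leg)
  have cont_T: "continuous_on A (T N)" for A N
    unfolding T_def leg_flux_def by (intro continuous_intros cont_leg)
  have cont_F: "continuous_on {0..t} (hyp_F s)" if "t \<le> x" for t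
    using that xy by (intro continuous_at_imp_continuous_on ballI isCont_hyp_F[OF s]) auto
  have cont_D: "continuous_on {0..t} (hyp_D s)" if "t \<le> x" for t
    using that xy by (intro continuous_at_imp_continuous_on ballI DERIV_isCont[OF has_derivative_hyp_D[OF s]]) auto
  \<comment> \<open>\<open>V N\<close> vanishes at 0, so the mean value theorem gives a bound with a
    factor \<open>u\<close>. This factor cancels the pole \<open>1 / u\<close> in the derivative of
    \<open>S N u / hyp_F s u\<close>.\<close>
  have V_bound: "\<bar>V N u\<bar> \<le> \<epsilon> N * u" if u: "u \<in> {0<..<x}" for N u
  proof -
    have "\<exists>l z. 0 < z \<and> z < u \<and> (V N has_real_derivative l) (at z) \<and> V N u - V N 0 = (u - 0) * l"
    proof (rule MVT)
      show "continuous_on {0..u} (V N)"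
        unfolding V_def using u by (intro continuous_intros cont_S cont_T cont_F cont_D) auto
      show "V N differentiable (at z)" if "0 < z" "z < u" for z
        using deriv_V[of z N] that u xy real_differentiable_def by auto
    qed (use u in auto)
    then obtain l z where z: "0 < z" "z < u" "(V N has_real_derivative l) (at z)" "V N u = V N 0 + u * l"
      by auto
    have z1: "z \<in> {0<..<1}" "z \<in> {0..x}" using z u xy by auto
    have l: "l = - ((real N)\<^sup>2 * hyp_coeff s N * leg_sep (N - 1) z y) * hyp_F s z"
      using DERIV_unique[OF z(3) deriv_V[OF z1(1)]] .
    have V0: "V N 0 = 0"
      using s by (simp add: V_def T_def)
    have zy: "0 \<le> z" "0 < y" "z + y < 1" using z1 xy by auto
    have "leg_sep (N - 1) z y \<le> (1 - (1 - z - y)\<^sup>2 / 2) ^ (N - 1)"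
      by (rule leg_sep_bounds[OF zy])
    also have "\<dots> \<le> R ^ (N - 1)"
    proof (rule power_mono)
      have "(1 - x - y)\<^sup>2 \<le> (1 - z - y)\<^sup>2"
        using z1 xy by (intro power_mono) auto
      thus "1 - (1 - z - y)\<^sup>2 / 2 \<le> R" by (simp add: R_def)
      have "(1 - z - y)\<^sup>2 \<le> 1" using zy by (simp add: abs_square_le_1)
      thus "0 \<le> 1 - (1 - z - y)\<^sup>2 / 2" by simp
    qed
    finally have q: "leg_sep (N - 1) z y \<le> R ^ (N - 1)" .
    have "\<bar>l\<bar> = (real N)\<^sup>2 * hyp_coeff s N * leg_sep (N - 1) z y * hyp_F s z"
      unfolding l using hyp_coeff_bounds[OF s, of N] leg_sep_bounds(1)[OF zy, of "N - 1"] F1[OF z1(2)]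
      by (simp add: abs_mult)
    also have "\<dots> \<le> (real N)\<^sup>2 * 1 * R ^ (N - 1) * B"
      using hyp_coeff_bounds[OF s, of N] leg_sep_bounds(1)[OF zy, of "N - 1"] F1[OF z1(2)] B[OF z1(2)] q R
      by (intro mult_mono) auto
    finally have "\<bar>l\<bar> \<le> \<epsilon> N" by (simp add: \<epsilon>_def)
    thus ?thesis using z(4) V0 u by (simp add: abs_mult mult.commute mult_left_mono)
  qed
  have ratio: "\<bar>S N x / hyp_F s x - S N 0\<bar> \<le> \<epsilon> N * (x / (1 - x))" for N
  proof -
    have Fnz: "hyp_F s u \<noteq> 0" if "u \<in> {0..x}" for u using F1[OF that] by auto
    have dQ: "((\<lambda>u. S N u / hyp_F s u) has_real_derivative V N u / (u * (1 - u) * (hyp_F s u)\<^sup>2)) (at u)"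
      if "u \<in> {0<..<x}" for u
    proof -
      have u: "u \<in> {0<..<1}" "u \<in> {0..x}" using that xy by auto
      have "((\<lambda>u. S N u / hyp_F s u) has_real_derivative
        (T N u / (u * (1 - u)) * hyp_F s u - S N u * (hyp_D s u / (u * (1 - u)))) / (hyp_F s u * hyp_F s u)) (at u)"
        using u by (intro DERIV_divide deriv_S has_derivative_hyp_F[OF s] Fnz) auto
      also have "(T N u / (u * (1 - u)) * hyp_F s u - S N u * (hyp_D s u / (u * (1 - u)))) / (hyp_F s u * hyp_F s u)
         = V N u / (u * (1 - u) * (hyp_F s u)\<^sup>2)"
        unfolding V_def power2_eq_square
        by (simp only: times_divide_eq_left times_divide_eq_right diff_divide_distrib[symmetric] divide_divide_eq_left)
      finally show ?thesis .
    qed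
    have "\<exists>l z. 0 < z \<and> z < x \<and> ((\<lambda>u. S N u / hyp_F s u) has_real_derivative l) (at z) \<and>
       S N x / hyp_F s x - S N 0 / hyp_F s 0 = (x - 0) * l"
    proof (rule MVT)
      show "continuous_on {0..x} (\<lambda>u. S N u / hyp_F s u)"
        using Fnz by (intro continuous_intros cont_S cont_F) auto
      show "(\<lambda>u. S N u / hyp_F s u) differentiable (at z)" if "0 < z" "z < x" for z
        using dQ[of z] that real_differentiable_def by auto
    qed (use xy in auto)
    then obtain l z where z: "z \<in> {0<..<x}" "((\<lambda>u. S N u / hyp_F s u) has_real_derivative l) (at z)"
      "S N x / hyp_F s x - S N 0 = x * l"
      using s by auto
    have l: "l = V N z / (z * (1 - z) * (hyp_F s z)\<^sup>2)"
      using DERIV_unique[OF z(2) dQ[OF z(1)]] .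
    have F2: "1 \<le> (hyp_F s z)\<^sup>2" using F1[of z] z by (auto simp: one_le_power)
    have "\<bar>l\<bar> = \<bar>V N z\<bar> / (z * (1 - z) * (hyp_F s z)\<^sup>2)"
      unfolding l using z xy by (simp add: abs_mult)
    also have "\<dots> \<le> \<epsilon> N * z / (z * (1 - x) * 1)"
      using V_bound[OF z(1), of N] z xy F2 by (intro frac_le mult_mono) auto
    also have "\<dots> = \<epsilon> N / (1 - x)" using z by simp
    finally have "x * \<bar>l\<bar> \<le> x * (\<epsilon> N / (1 - x))" using xy by (intro mult_left_mono) auto
    thus ?thesis unfolding z(3) using xy by (simp add: abs_mult mult.commute)
  qed
  have "(\<lambda>N. (real N)\<^sup>2 * R ^ N * (B / R)) \<longlonglongrightarrow> 0 * (B / R)"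
  proof (intro tendsto_mult tendsto_const)
    have "(\<lambda>N. (real N * sqrt R ^ N)\<^sup>2) \<longlonglongrightarrow> 0\<^sup>2"
      using R by (intro tendsto_power powser_times_n_limit_0) auto
    also have "(\<lambda>N. (real N * sqrt R ^ N)\<^sup>2) = (\<lambda>N. (real N)\<^sup>2 * R ^ N)"
    proof
      show "(real N * sqrt R ^ N)\<^sup>2 = (real N)\<^sup>2 * R ^ N" for N
        using R by (simp add: power_mult_distrib power_mult[symmetric] mult.commute[of _ 2] power_mult[of _ 2])
    qed
    finally show "(\<lambda>N. (real N)\<^sup>2 * R ^ N) \<longlonglongrightarrow> 0" by simp
  qed
  also have "(\<lambda>N. (real N)\<^sup>2 * R ^ N * (B / R)) = \<epsilon>"
  proof
    show "(real N)\<^sup>2 * R ^ N * (B / R) = \<epsilon> N" for N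
      using R by (cases N) (auto simp: \<epsilon>_def)
  qed
  finally have "(\<lambda>N. \<epsilon> N * (x / (1 - x))) \<longlonglongrightarrow> 0 * (x / (1 - x))"
    by (intro tendsto_mult tendsto_const) simp
  hence "(\<lambda>N. \<epsilon> N * (x / (1 - x))) \<longlonglongrightarrow> 0" by simp
  hence "(\<lambda>N. S N x / hyp_F s x - S N 0) \<longlonglongrightarrow> 0"
    by (rule Lim_null_comparison[rotated]) (use ratio in auto)
  \<comment> \<open>At the left end \<open>leg_sep n 0 y = y ^ n\<close>, so the limit there is
    \<open>hyp_F s y\<close>; this fixes the constant of proportionality.\<close>
  moreover have "(\<lambda>N. S N 0) \<longlonglongrightarrow> hyp_F s y"
    using hyp_F_sums[OF s, of y] xy by (simp add: S_def sums_def)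
  ultimately have "(\<lambda>N. (S N x / hyp_F s x - S N 0) + S N 0) \<longlonglongrightarrow> 0 + hyp_F s y"
    by (rule tendsto_add)
  hence "(\<lambda>N. hyp_F s x * (S N x / hyp_F s x)) \<longlonglongrightarrow> hyp_F s x * hyp_F s y"
    by (intro tendsto_mult tendsto_const) simp
  also have "(\<lambda>N. hyp_F s x * (S N x / hyp_F s x)) = (\<lambda>N. S N x)"
    using F1[of x] xy by (auto simp: fun_eq_iff)
  finally show ?thesis by (simp add: S_def sums_def)
qed

text \<open>Convergence at points beyond 1 forces a radius of convergence above 1, so the series may
  be differentiated termwise near 1. \<open>H'\<close> stands for \<open>t d/dt H\<close>; stating
  everything on a neighbourhood lets the lemma be iterated.\<close>

lemma euler_derivative_sums:
  fixes a :: "nat \<Rightarrow> real"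
  assumes "\<forall>\<^sub>F t in nhds 1. (\<lambda>n. a n * t ^ n) sums H t"
    and "\<forall>\<^sub>F t in nhds 1. (H has_real_derivative H' t / t) (at t)"
  shows "\<forall>\<^sub>F t in nhds 1. (\<lambda>n. real n * a n * t ^ n) sums H' t"
proof -
  from assms(1) obtain d where d: "d > 0" "\<And>t. dist t 1 < d \<Longrightarrow> (\<lambda>n. a n * t ^ n) sums H t"
    by (auto simp: eventually_nhds_metric)
  have sm: "summable (\<lambda>n. a n * z ^ n)" if "norm z < 1 + d" for z
  proof -
    \<comment> \<open>A point within distance \<open>d\<close> of 1, where the series converges, and
      of larger modulus than \<open>z\<close>.\<close>
    define u where "u = max 1 ((\<bar>z\<bar> + (1 + d)) / 2)"
    have "dist u 1 < d" "\<bar>z\<bar> < \<bar>u\<bar>" using that d(1) by (auto simp: u_def dist_real_def abs_if field_simps max_def)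
    thus ?thesis
      using powser_inside[of a u z] d(2)[of u] by (auto dest: sums_summable)
  qed
  have "\<forall>\<^sub>F t in nhds 1. t \<in> ball 1 (min d 1)"
    using d(1) by (intro eventually_nhds_in_open) auto
  with assms(2) show ?thesis
  proof eventually_elim
    case (elim t)
    hence t: "0 < t" "norm t < 1 + d" by (auto simp: dist_real_def abs_if split: if_splits)
    have "((\<lambda>z. \<Sum>n. a n * z ^ n) has_real_derivative (\<Sum>n. diffs a n * t ^ n)) (at t)"
      by (rule termdiffs_strong'[OF _ t(2)]) (rule sm)
    hence "(H has_real_derivative (\<Sum>n. diffs a n * t ^ n)) (at t)"
    proof (rule has_field_derivative_transform_within_open[OF _ open_ball[of 1 d]])
      show "t \<in> ball 1 d" using elim by auto
      show "(\<Sum>n. a n * z ^ n) = H z" if "z \<in> ball 1 d" for z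
        using d(2)[of z] that by (simp add: sums_iff dist_commute)
    qed
    hence eq: "(\<Sum>n. diffs a n * t ^ n) = H' t / t"
      using DERIV_unique elim by blast
    have "summable (\<lambda>n. diffs a n * t ^ n)"
      by (rule termdiff_converges[OF t(2) sm])
    hence "(\<lambda>n. t * (diffs a n * t ^ n)) sums (t * (H' t / t))"
      unfolding eq[symmetric] by (intro sums_mult summable_sums)
    hence "(\<lambda>n. real (Suc n) * a (Suc n) * t ^ Suc n) sums H' t"
      using t by (simp add: diffs_def mult_ac)
    thus ?case
      by (subst (asm) sums_Suc_iff) simp
  qed
qed

text \<open>The right-hand sides are the first three Euler derivatives at \<open>t = 1\<close> of
  \<open>F(X) F(Y)\<close> along a curve on which \<open>w\<close> and \<open>z\<close> both scale
  by \<open>t\<close>. Products of one of \<open>f\<close>, \<open>f1\<close> with one of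
  \<open>g\<close>, \<open>g1\<close> stay in their own span, since \<open>hyp_F\<close> and
  \<open>hyp_D\<close> form a first order system.\<close>

lemma brafman_euler_derivatives:
  fixes x y s :: real
  assumes s: "0 < s" "s < 1" and xy: "0 < x" "0 < y" "x + y < 1"
  defines "f \<equiv> hyp_F s x" and "f1 \<equiv> hyp_D s x" and "g \<equiv> hyp_F s y" and "g1 \<equiv> hyp_D s y"
    and "\<sigma> \<equiv> s * (1 - s)" and "r \<equiv> 1 - x - y" and "p \<equiv> x * (1 - x)" and "q \<equiv> y * (1 - y)"
  defines "m \<equiv> p + q" and "m1 \<equiv> (1 - 2 * x) * p + (1 - 2 * y) * q"
  defines "A \<equiv> f1 * g + f * g1" and "C \<equiv> \<sigma> * (p * f * g1 + q * f1 * g)"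
  defines "B \<equiv> \<sigma> * m * (f * g) + 2 * (f1 * g1)"
  shows "(\<lambda>n. real n * (hyp_coeff s n * leg_sep n x y)) sums (A / r)"
    and "(\<lambda>n. real n ^ 2 * (hyp_coeff s n * leg_sep n x y)) sums (B / r^2 + m * A / r^3)"
    and "(\<lambda>n. real n ^ 3 * (hyp_coeff s n * leg_sep n x y)) sums
           ((\<sigma> * (m1 * (f * g) + m * A) + 2 * C) / r^3 + (3 * m * B + m1 * A) / r^4 + 3 * m^2 * A / r^5)"
proof -
  define w where "w = x + y - 2 * x * y"
  define z where "z = y - x"
  \<comment> \<open>\<open>R t\<close> is \<open>1 - X - Y\<close> along the curve; solving
    \<open>X + Y = 1 - R t\<close> and \<open>Y - X = z * t\<close> gives \<open>X\<close> and
    \<open>Y\<close>.\<close>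
  define rad where "rad = (\<lambda>t. 1 - 2 * w * t + z\<^sup>2 * t\<^sup>2)"
  define R where "R = (\<lambda>t. sqrt (rad t))"
  define X where "X = (\<lambda>t. (1 - R t - z * t) / 2)"
  define Y where "Y = (\<lambda>t. (1 - R t + z * t) / 2)"
  define P where "P = (\<lambda>t. X t * (1 - X t))"
  define Q where "Q = (\<lambda>t. Y t * (1 - Y t))"
  define F where "F = (\<lambda>t. hyp_F s (X t))"
  define F1 where "F1 = (\<lambda>t. hyp_D s (X t))"
  define G where "G = (\<lambda>t. hyp_F s (Y t))"
  define G1 where "G1 = (\<lambda>t. hyp_D s (Y t))"
  define M where "M = (\<lambda>t. P t + Q t)"
  define M1 where "M1 = (\<lambda>t. (1 - 2 * X t) * P t + (1 - 2 * Y t) * Q t)"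
  define AA where "AA = (\<lambda>t. F1 t * G t + F t * G1 t)"
  define CC where "CC = (\<lambda>t. \<sigma> * (P t * F t * G1 t + Q t * F1 t * G t))"
  define BB where "BB = (\<lambda>t. \<sigma> * M t * (F t * G t) + 2 * (F1 t * G1 t))"
  define H1 where "H1 = (\<lambda>t. AA t / R t)"
  define H2 where "H2 = (\<lambda>t. BB t / R t ^ 2 + M t * AA t / R t ^ 3)"
  define H3 where "H3 = (\<lambda>t. (\<sigma> * (M1 t * (F t * G t) + M t * AA t) + 2 * CC t) / R t ^ 3
      + (3 * M t * BB t + M1 t * AA t) / R t ^ 4 + 3 * M t ^ 2 * AA t / R t ^ 5)"
  note defs = w_def z_def rad_def
  have rad1: "rad 1 = r\<^sup>2"
    by (simp add: defs r_def power2_eq_square algebra_simps)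
  have R1: "R 1 = r" using xy by (simp add: R_def rad1 r_def)
  have X1: "X 1 = x" and Y1: "Y 1 = y"
    by (simp_all add: X_def Y_def R1 r_def z_def)
  have lim: "((\<lambda>t::real. t) \<longlongrightarrow> 1) (nhds 1)" by (rule filterlim_ident)
  have rad_lim: "(rad \<longlongrightarrow> rad 1) (nhds 1)" unfolding rad_def by (intro tendsto_intros lim)
  have R_lim: "(R \<longlongrightarrow> R 1) (nhds 1)" unfolding R_def by (intro tendsto_intros rad_lim)
  have X_lim: "(X \<longlongrightarrow> X 1) (nhds 1)" unfolding X_def by (intro tendsto_intros R_lim lim) auto
  have Y_lim: "(Y \<longlongrightarrow> Y 1) (nhds 1)" unfolding Y_def by (intro tendsto_intros R_lim lim) auto
  have good: "\<forall>\<^sub>F t in nhds 1. 0 < t \<and> 0 < rad t \<and> 0 < X t \<and> 0 < Y t"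
  proof (intro eventually_conj)
    show "\<forall>\<^sub>F t in nhds 1. (0::real) < t" using lim by (rule order_tendstoD) auto
    show "\<forall>\<^sub>F t in nhds 1. 0 < rad t" using rad_lim by (rule order_tendstoD) (use xy in \<open>simp add: rad1 r_def\<close>)
    show "\<forall>\<^sub>F t in nhds 1. 0 < X t" using X_lim by (rule order_tendstoD) (use xy in \<open>simp add: X1\<close>)
    show "\<forall>\<^sub>F t in nhds 1. 0 < Y t" using Y_lim by (rule order_tendstoD) (use xy in \<open>simp add: Y1\<close>)
  qed
  have sums0: "\<forall>\<^sub>F t in nhds 1. (\<lambda>n. hyp_coeff s n * leg_sep n x y * t ^ n) sums (F t * G t)"
    using good
  proof eventually_elim
    case (elim t)
    have R2: "R t * R t = 1 - 2 * w * t + z\<^sup>2 * t\<^sup>2" and R0: "0 < R t"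
      using elim by (simp_all add: R_def rad_def)
    have "X t + Y t < 1" using R0 by (simp add: X_def Y_def field_simps)
    hence "(\<lambda>n. hyp_coeff s n * leg_sep n (X t) (Y t)) sums (F t * G t)"
      unfolding F_def G_def using elim by (intro brafman s) auto
    moreover have "X t + Y t - 2 * X t * Y t = w * t"
      using R2 by (simp add: X_def Y_def field_simps power2_eq_square)
    moreover have "(Y t - X t)\<^sup>2 = z\<^sup>2 * t\<^sup>2"
      by (simp add: X_def Y_def field_simps power2_eq_square)
    hence "leg_sep n (X t) (Y t) = leg_sep n x y * t ^ n" for n
      using \<open>X t + Y t - 2 * X t * Y t = w * t\<close>
      by (simp only: leg_sep_def leg_hom_scale) (simp add: w_def z_def)
    ultimately show ?case
      by (simp add: mult_ac)
  qed
  \<comment> \<open>Under \<open>t d/dt\<close> the rates are \<open>P / R\<close> for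
    \<open>X\<close>, \<open>Q / R\<close> for \<open>Y\<close> and \<open>- (P + Q) / R\<close> for
    \<open>R\<close>. The factors \<open>P\<close> and \<open>Q\<close> cancel the denominators of
    \<open>has_derivative_hyp_F\<close>.\<close>
  have derivs: "(R has_real_derivative (1 / (R t * t)) * (- M t)) (at t) \<and>
      (X has_real_derivative (1 / (R t * t)) * P t) (at t) \<and>
      (Y has_real_derivative (1 / (R t * t)) * Q t) (at t) \<and> R t \<noteq> 0 \<and> t \<noteq> 0 \<and> X t \<in> {0<..<1} \<and> Y t \<in> {0<..<1}"
    if t: "0 < t \<and> 0 < rad t \<and> 0 < X t \<and> 0 < Y t" for t
  proof -
    have R2: "R t * R t = 1 - 2 * w * t + z\<^sup>2 * t\<^sup>2" and R0: "0 < R t"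
      using t by (simp_all add: R_def rad_def)
    have "X t + Y t < 1" using R0 by (simp add: X_def Y_def field_simps)
    hence XY: "X t \<in> {0<..<1}" "Y t \<in> {0<..<1}" using t by auto
    \<comment> \<open>\<open>M t\<close> is \<open>- t / 2\<close> times the derivative of
      \<open>rad\<close>, which gives the rate of \<open>R\<close>.\<close>
    have M: "M t = w * t - z\<^sup>2 * t\<^sup>2"
      using R2 by (simp add: M_def P_def Q_def X_def Y_def field_simps power2_eq_square)
    have PQ: "P t - Q t = - z * t * R t"
      by (simp add: P_def Q_def X_def Y_def field_simps power2_eq_square)
    have "(rad has_real_derivative (- 2 * w + 2 * z\<^sup>2 * t)) (at t)"
      unfolding rad_def by (auto intro!: derivative_eq_intros)
    hence "(R has_real_derivative (- 2 * w + 2 * z\<^sup>2 * t) * (inverse (R t) / 2)) (at t)"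
      unfolding R_def using t by (auto intro!: derivative_eq_intros)
    also have "(- 2 * w + 2 * z\<^sup>2 * t) * (inverse (R t) / 2) = (1 / (R t * t)) * (- M t)"
      unfolding M using t R0 by (simp add: field_simps power2_eq_square)
    finally have dR: "(R has_real_derivative (1 / (R t * t)) * (- M t)) (at t)" .
    have "(X has_real_derivative (- ((1 / (R t * t)) * (- M t)) - z) / 2) (at t)"
      unfolding X_def by (auto intro!: derivative_eq_intros dR)
    also have "(- ((1 / (R t * t)) * (- M t)) - z) / 2 = (1 / (R t * t)) * ((M t - z * t * R t) / 2)"
      using t R0 by (simp add: field_simps)
    also have "(M t - z * t * R t) / 2 = P t"
      using PQ by (simp add: M_def)
    finally have dX: "(X has_real_derivative (1 / (R t * t)) * P t) (at t)" .
    have "(Y has_real_derivative (- ((1 / (R t * t)) * (- M t)) + z) / 2) (at t)"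
      unfolding Y_def by (auto intro!: derivative_eq_intros dR)
    also have "(- ((1 / (R t * t)) * (- M t)) + z) / 2 = (1 / (R t * t)) * ((M t + z * t * R t) / 2)"
      using t R0 by (simp add: field_simps)
    also have "(M t + z * t * R t) / 2 = Q t"
      using PQ by (simp add: M_def)
    finally have dY: "(Y has_real_derivative (1 / (R t * t)) * Q t) (at t)" .
    show ?thesis using dR dX dY R0 t XY by auto
  qed
  have dH: "((\<lambda>t. F t * G t) has_real_derivative H1 t / t) (at t) \<and>
     (H1 has_real_derivative H2 t / t) (at t) \<and> (H2 has_real_derivative H3 t / t) (at t)"
    if t: "0 < t \<and> 0 < rad t \<and> 0 < X t \<and> 0 < Y t" for t
  proof -
    define c where "c = 1 / (R t * t)"
    from derivs[OF t] have dR: "(R has_real_derivative c * (- M t)) (at t)"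
      and dX: "(X has_real_derivative c * P t) (at t)" and dY: "(Y has_real_derivative c * Q t) (at t)"
      and nz: "R t \<noteq> 0" "t \<noteq> 0" and XY: "X t \<in> {0<..<1}" "Y t \<in> {0<..<1}"
      by (simp_all add: c_def)
    have PQ: "P t \<noteq> 0" "Q t \<noteq> 0" using XY by (auto simp: P_def Q_def)
    have "(F has_real_derivative hyp_D s (X t) / (X t * (1 - X t)) * (c * P t)) (at t)"
      unfolding F_def using XY by (intro DERIV_chain2[OF has_derivative_hyp_F[OF s] dX]) auto
    hence dF: "(F has_real_derivative c * F1 t) (at t)"
      using PQ by (simp add: F1_def P_def mult.commute)
    have "(G has_real_derivative hyp_D s (Y t) / (Y t * (1 - Y t)) * (c * Q t)) (at t)"
      unfolding G_def using XY by (intro DERIV_chain2[OF has_derivative_hyp_F[OF s] dY]) auto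
    hence dG: "(G has_real_derivative c * G1 t) (at t)"
      using PQ by (simp add: G1_def Q_def mult.commute)
    have "(F1 has_real_derivative s * (1 - s) * hyp_F s (X t) * (c * P t)) (at t)"
      unfolding F1_def using XY by (intro DERIV_chain2[OF has_derivative_hyp_D[OF s] dX]) auto
    hence dF1: "(F1 has_real_derivative c * (\<sigma> * P t * F t)) (at t)"
      by (simp add: F_def \<sigma>_def mult_ac)
    have "(G1 has_real_derivative s * (1 - s) * hyp_F s (Y t) * (c * Q t)) (at t)"
      unfolding G1_def using XY by (intro DERIV_chain2[OF has_derivative_hyp_D[OF s] dY]) auto
    hence dG1: "(G1 has_real_derivative c * (\<sigma> * Q t * G t)) (at t)"
      by (simp add: G_def \<sigma>_def mult_ac)
    have dM: "(M has_real_derivative c * M1 t) (at t)"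
      unfolding M_def[abs_def] P_def[abs_def] Q_def[abs_def]
      by (auto intro!: derivative_eq_intros dX dY simp: M1_def P_def Q_def algebra_simps)
    have dFG: "((\<lambda>t. F t * G t) has_real_derivative c * AA t) (at t)"
      by (auto intro!: derivative_eq_intros dF dG simp: AA_def algebra_simps)
    have dFG1: "((\<lambda>t. F1 t * G1 t) has_real_derivative c * CC t) (at t)"
      by (auto intro!: derivative_eq_intros dF1 dG1 simp: CC_def algebra_simps)
    have dAA: "(AA has_real_derivative c * BB t) (at t)"
      unfolding AA_def[abs_def]
      by (auto intro!: derivative_eq_intros dF dG dF1 dG1 simp: BB_def M_def algebra_simps)
    have dBB: "(BB has_real_derivative c * (\<sigma> * (M1 t * (F t * G t) + M t * AA t) + 2 * CC t)) (at t)"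
      unfolding BB_def[abs_def]
      by (rule DERIV_cong[OF DERIV_add[OF DERIV_mult[OF DERIV_cmult[OF dM] dFG] DERIV_cmult[OF dFG1]]])
         (simp add: algebra_simps)
    have "((\<lambda>t. AA t / R t) has_real_derivative (c * BB t * R t - AA t * (c * (- M t))) / (R t * R t)) (at t)"
      by (rule DERIV_divide[OF dAA dR nz(1)])
    hence dH1: "(H1 has_real_derivative H2 t / t) (at t)"
      unfolding H1_def by (rule DERIV_cong) (use nz in \<open>simp add: H2_def c_def field_simps power2_eq_square power3_eq_cube\<close>)
    have dR2: "((\<lambda>t. R t ^ 2) has_real_derivative c * (- 2 * M t * R t)) (at t)"
      by (auto intro!: derivative_eq_intros dR simp: algebra_simps)
    have dR3: "((\<lambda>t. R t ^ 3) has_real_derivative c * (- 3 * M t * R t ^ 2)) (at t)"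
      by (auto intro!: derivative_eq_intros dR simp: algebra_simps)
    have "((\<lambda>t. BB t / R t ^ 2 + M t * AA t / R t ^ 3) has_real_derivative
       (c * (\<sigma> * (M1 t * (F t * G t) + M t * AA t) + 2 * CC t) * R t ^ 2 - BB t * (c * (- 2 * M t * R t))) / (R t ^ 2 * R t ^ 2)
       + ((c * M1 t * AA t + c * BB t * M t) * R t ^ 3 - M t * AA t * (c * (- 3 * M t * R t ^ 2))) / (R t ^ 3 * R t ^ 3)) (at t)"
      using nz by (intro DERIV_add DERIV_divide DERIV_mult dBB dR2 dR3 dM dAA) auto
    hence dH2: "(H2 has_real_derivative H3 t / t) (at t)"
      unfolding H2_def
    proof (rule DERIV_cong)
      define K where "K = \<sigma> * (M1 t * (F t * G t) + M t * AA t) + 2 * CC t"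
      show "(c * (\<sigma> * (M1 t * (F t * G t) + M t * AA t) + 2 * CC t) * R t ^ 2 - BB t * (c * (- 2 * M t * R t))) / (R t ^ 2 * R t ^ 2)
       + ((c * M1 t * AA t + c * BB t * M t) * R t ^ 3 - M t * AA t * (c * (- 3 * M t * R t ^ 2))) / (R t ^ 3 * R t ^ 3) = H3 t / t"
        unfolding H3_def K_def[symmetric] c_def using nz by (simp add: field_simps eval_nat_numeral)
    qed
    have "c * AA t = H1 t / t" by (simp add: H1_def c_def)
    thus ?thesis using dFG dH1 dH2 by simp
  qed
  have S1: "\<forall>\<^sub>F t in nhds 1. (\<lambda>n. real n * (hyp_coeff s n * leg_sep n x y) * t ^ n) sums H1 t"
    by (rule euler_derivative_sums[OF sums0]) (rule eventually_mono[OF good], use dH in blast)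
  have S2: "\<forall>\<^sub>F t in nhds 1. (\<lambda>n. real n * (real n * (hyp_coeff s n * leg_sep n x y)) * t ^ n) sums H2 t"
    by (rule euler_derivative_sums[OF S1]) (rule eventually_mono[OF good], use dH in blast)
  have S3: "\<forall>\<^sub>F t in nhds 1. (\<lambda>n. real n * (real n * (real n * (hyp_coeff s n * leg_sep n x y))) * t ^ n) sums H3 t"
    by (rule euler_derivative_sums[OF S2]) (rule eventually_mono[OF good], use dH in blast)
  have at1: "F 1 = f" "F1 1 = f1" "G 1 = g" "G1 1 = g1" "P 1 = p" "Q 1 = q"
    by (simp_all add: F_def F1_def G_def G1_def P_def Q_def X1 Y1 f_def f1_def g_def g1_def p_def q_def)
  have at1': "M 1 = m" "M1 1 = m1" "AA 1 = A" "CC 1 = C" "BB 1 = B"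
    by (simp_all add: M_def M1_def AA_def CC_def BB_def at1 X1 Y1 m_def m1_def A_def C_def B_def)
  show "(\<lambda>n. real n * (hyp_coeff s n * leg_sep n x y)) sums (A / r)"
    using eventually_nhds_x_imp_x[OF S1] by (simp add: H1_def at1' R1)
  show "(\<lambda>n. real n ^ 2 * (hyp_coeff s n * leg_sep n x y)) sums (B / r^2 + m * A / r^3)"
    using eventually_nhds_x_imp_x[OF S2] by (simp add: H2_def at1' R1 power2_eq_square mult.assoc)
  show "(\<lambda>n. real n ^ 3 * (hyp_coeff s n * leg_sep n x y)) sums
           ((\<sigma> * (m1 * (f * g) + m * A) + 2 * C) / r^3 + (3 * m * B + m1 * A) / r^4 + 3 * m^2 * A / r^5)"
    using eventually_nhds_x_imp_x[OF S3] by (simp add: H3_def at1 at1' R1 power3_eq_cube mult.assoc)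
qed


section \<open>The cubic parametrisation\<close>

text \<open>\<open>1 - x - y\<close> factors as
  \<open>k (1 - k) (3 + 4 k + 2 k^2) (3 + 2 k + 4 k^2) / (1 + 2 k)^3\<close>. The square of this
  numerator reappears in \<open>C3\<close>.\<close>

lemma cubic_param_bounds:
  fixes k :: real
  assumes "0 < k" "k < 1"
  shows "0 < ((1 - k) / (1 + 2 * k)) ^ 3" "k ^ 3 + ((1 - k) / (1 + 2 * k)) ^ 3 < 1"
proof -
  show "0 < ((1 - k) / (1 + 2 * k)) ^ 3" using assms by simp
  have e: "(1 + 2 * k) ^ 3 > 0" using assms by simp
  have "(1 - k ^ 3) * (1 + 2 * k) ^ 3 - (1 - k) ^ 3 =
      k * (1 - k) * ((3 + 4 * k + 2 * k^2) * (3 + 2 * k + 4 * k^2))"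
    by algebra
  also have "\<dots> > 0" using assms by (intro mult_pos_pos add_pos_pos) auto
  finally have "(1 - k) ^ 3 / (1 + 2 * k) ^ 3 < 1 - k ^ 3"
    using e by (simp add: divide_less_eq)
  thus "k ^ 3 + ((1 - k) / (1 + 2 * k)) ^ 3 < 1" by (simp add: power_divide)
qed

section \<open>Matching the Legendre terms with the separated variables\<close>

lemma arg_z_eq:
  assumes "0 < k" "k < 1"
  shows "arg_z k = ((1 - k) / (1 + 2 * k)) ^ 3 - k ^ 3"
proof -
  have e: "(1 + 2 * k) ^ 3 \<noteq> 0" using assms by simp
  have "(1 + k + k^2) * (1 - 2*k - 2*k^2) * (1 - 2*k + 4*k^2) = (1 - k) ^ 3 - k ^ 3 * (1 + 2 * k) ^ 3"
    by algebra
  thus ?thesis unfolding arg_z_def power_divide using e by (simp add: diff_divide_distrib)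
qed

lemma arg_x_arg_z_eq:
  assumes "0 < k" "k < 1" "1 - 2*k - 2*k^2 \<noteq> 0"
  shows "arg_x k * arg_z k = k ^ 3 + ((1 - k) / (1 + 2 * k)) ^ 3 - 2 * k ^ 3 * ((1 - k) / (1 + 2 * k)) ^ 3"
proof -
  have e: "(1 + 2 * k) ^ 3 \<noteq> 0" using assms by simp
  have "1 - 2*k + 4*k^2 = (1 - k)^2 + 3 * k^2" by algebra
  also have "\<dots> > 0" using assms by (intro add_pos_pos) auto
  finally have "arg_x k * arg_z k = (1 + k + k^2) * (1 - 4*k + 6*k^2 - 4*k^3 + 10*k^4) / (1 + 2*k)^3"
    using assms e by (simp add: arg_x_def arg_z_def)
  also have "(1 + k + k^2) * (1 - 4*k + 6*k^2 - 4*k^3 + 10*k^4) =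
      k ^ 3 * (1 + 2*k)^3 + (1 - k)^3 - 2 * k ^ 3 * (1 - k) ^ 3"
    by algebra
  finally show ?thesis
    unfolding power_divide using e by (simp add: diff_divide_distrib add_divide_distrib)
qed

text \<open>Away from the zero of \<open>1 - 2k - 2k^2\<close> this is homogeneity. The right-hand
  side is continuous on the whole interval, so at the zero it agrees with the limit that defines the
  term.\<close>

lemma legendre_term_eq_leg_sep:
  assumes k: "0 < k" "k < 1"
  shows "legendre_term n k = leg_sep n (k ^ 3) (((1 - k) / (1 + 2 * k)) ^ 3)"
proof -
  define k0 where "k0 = (sqrt 3 - 1) / (2 :: real)"
  define L where "L = (\<lambda>t::real. leg_sep n (t ^ 3) (((1 - t) / (1 + 2 * t)) ^ 3))"
  have k0: "2 * k0\<^sup>2 = 1 - 2 * k0"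
  proof -
    have "2 * k0 + 1 = sqrt 3" by (simp add: k0_def field_simps)
    hence "(2 * k0 + 1)\<^sup>2 = 3" by simp
    thus ?thesis by (simp add: power2_eq_square algebra_simps)
  qed
  have "k0 > 0" by (simp add: k0_def)
  have eq: "legendre_P n (arg_x t) * arg_z t ^ n = L t" if t: "0 < t" "t < 1" "t \<noteq> k0" for t
  proof -
    have "1 - 2*t - 2*t^2 = 2 * (k0 - t) * (k0 + t + 1)"
      using k0 by (simp add: power2_eq_square algebra_simps)
    hence nz: "1 - 2*t - 2*t^2 \<noteq> 0" using t \<open>k0 > 0\<close> by auto
    have "legendre_P n (arg_x t) * arg_z t ^ n = leg_hom n (arg_x t * arg_z t) ((arg_z t)\<^sup>2)"
      using leg_hom_scale[of n "arg_x t" "arg_z t" 1] by (simp add: legendre_P_eq_leg_hom)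
    thus ?thesis
      unfolding arg_x_arg_z_eq[OF t(1,2) nz] unfolding arg_z_eq[OF t(1,2)] by (simp add: L_def leg_sep_def)
  qed
  show ?thesis
  proof (cases "k = k0")
    case False
    thus ?thesis using eq[OF k] by (simp add: legendre_term_def k0_def L_def)
  next
    case True
    have "continuous_on {0<..<1} L"
      unfolding L_def leg_sep_def by (intro continuous_intros) auto
    hence "isCont L k" using k by (simp add: continuous_on_eq_continuous_at)
    hence "L \<midarrow>k\<rightarrow> L k" by (simp add: isCont_def)
    moreover have "\<forall>\<^sub>F t in nhds k. t \<in> {0<..<1}"
      using k by (intro eventually_nhds_in_open) auto
    hence "\<forall>\<^sub>F t in at k. L t = legendre_P n (arg_x t) * arg_z t ^ n"
      unfolding eventually_at_filter by eventually_elim (use eq True in auto)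
    ultimately have "(\<lambda>t. legendre_P n (arg_x t) * arg_z t ^ n) \<midarrow>k\<rightarrow> L k"
      by (rule Lim_transform_eventually)
    moreover have "(\<lambda>t. legendre_P n (arg_x t) * arg_z t ^ n) \<midarrow>k\<rightarrow> legendre_term n k"
      by (rule legendre_term_tendsto) (use True in \<open>simp add: k0_def\<close>)
    ultimately have "L k = legendre_term n k" by (intro tendsto_unique) auto
    thus ?thesis by (simp add: L_def)
  qed
qed

text \<open>A cubic analogue of Legendre's relation. With \<open>phi = hyp_F (1/3) x\<close> and
  \<open>psi = hyp_F (1/3) y / (1 + 2 k)\<close>, the left-hand side is
  \<open>k (1 - k^3) (phi' psi - phi psi')\<close> written in flux variables; the prefactor makes
  the Wronskian constant.\<close>

lemma cubic_legendre_relation: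
  fixes k :: real
  assumes k: "0 < k" "k < 1"
  defines "x \<equiv> k ^ 3" and "y \<equiv> ((1 - k) / (1 + 2 * k)) ^ 3" and "e \<equiv> 1 + 2 * k"
  defines "f \<equiv> hyp_F (1/3) x" and "f1 \<equiv> hyp_D (1/3) x" and "g \<equiv> hyp_F (1/3) y" and "g1 \<equiv> hyp_D (1/3) y"
  shows "e * f * g1 + 2 * k * (1 - k ^ 3) / e\<^sup>2 * (f * g) + 3 / e * (f1 * g) = sqrt 3 / (2 * pi)"
proof -
  have s: "0 < (1/3::real)" "1/3 < (1::real)" by auto
  define Y where "Y = (\<lambda>t::real. ((1 - t) / (1 + 2 * t)) ^ 3)"
  define F where "F = (\<lambda>t::real. hyp_F (1/3) (t ^ 3))"
  define F1 where "F1 = (\<lambda>t::real. hyp_D (1/3) (t ^ 3))"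
  define G where "G = (\<lambda>t::real. hyp_F (1/3) (Y t))"
  define G1 where "G1 = (\<lambda>t::real. hyp_D (1/3) (Y t))"
  define W where "W = (\<lambda>t. (1 + 2 * t) * F t * G1 t + 2 * t * (1 - t ^ 3) / (1 + 2 * t)\<^sup>2 * (F t * G t) + 3 / (1 + 2 * t) * (F1 t * G t))"
  have dW: "(W has_real_derivative 0) (at t)" if t: "t \<in> {0<..<1}" for t
  proof -
    define E where "E = 1 + 2 * t"
    have E: "E > 0" using t by (simp add: E_def)
    have t3: "t ^ 3 \<in> {0<..<1}" using t by (simp add: power_less_one_iff)
    have Y1: "Y t \<in> {0<..<1}" using cubic_param_bounds[of t] t3 t unfolding Y_def greaterThanLessThan_iff by linarith
    have dx: "((\<lambda>t. t ^ 3) has_real_derivative 3 * t\<^sup>2) (at t)"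
      by (auto intro!: derivative_eq_intros)
    have "((\<lambda>t. (1 - t) / (1 + 2 * t)) has_real_derivative ((0 - 1) * (1 + 2 * t) - (1 - t) * 2) / ((1 + 2 * t) * (1 + 2 * t))) (at t)"
      by (rule DERIV_divide) (use E in \<open>auto intro!: derivative_eq_intros simp: E_def\<close>)
    hence "((\<lambda>t. (1 - t) / (1 + 2 * t)) has_real_derivative - 3 / E\<^sup>2) (at t)"
      by (rule DERIV_cong) (simp add: E_def power2_eq_square algebra_simps)
    hence "(Y has_real_derivative real 3 * (- 3 / E\<^sup>2 * ((1 - t) / (1 + 2 * t)) ^ (3 - Suc 0))) (at t)"
      unfolding Y_def by (rule DERIV_power)
    hence dY: "(Y has_real_derivative - 9 * (1 - t)\<^sup>2 / E ^ 4) (at t)"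
      by (rule DERIV_cong) (simp add: E_def[symmetric] power_divide power_add[symmetric])
    have "(F has_real_derivative hyp_D (1/3) (t ^ 3) / (t ^ 3 * (1 - t ^ 3)) * (3 * t\<^sup>2)) (at t)"
      unfolding F_def using t3 by (intro DERIV_chain2[OF has_derivative_hyp_F[OF s] dx]) auto
    hence dF: "(F has_real_derivative 3 / (t * (1 - t ^ 3)) * F1 t) (at t)"
      by (rule DERIV_cong) (use t t3 in \<open>simp add: F1_def field_simps power2_eq_square power3_eq_cube\<close>)
    have "(F1 has_real_derivative (1/3) * (1 - 1/3) * hyp_F (1/3) (t ^ 3) * (3 * t\<^sup>2)) (at t)"
      unfolding F1_def using t3 by (intro DERIV_chain2[OF has_derivative_hyp_D[OF s] dx]) auto
    hence dF1: "(F1 has_real_derivative 2 / 3 * t\<^sup>2 * F t) (at t)"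
      by (rule DERIV_cong) (simp add: F_def)
    \<comment> \<open>The factor \<open>1 + t + t^2\<close> also divides \<open>1 - t ^ 3\<close>,
      so the derivatives of \<open>F\<close> and \<open>G\<close> share the denominator
      \<open>t * (1 - t ^ 3)\<close>.\<close>
    have q: "Y t * (1 - Y t) = (1 - t) ^ 3 * (9 * t * (1 + t + t\<^sup>2)) / E ^ 6"
    proof -
      have "E ^ 3 - (1 - t) ^ 3 = 9 * t * (1 + t + t\<^sup>2)" unfolding E_def by algebra
      moreover have "Y t * (1 - Y t) = (1 - t) ^ 3 * (E ^ 3 - (1 - t) ^ 3) / (E ^ 3 * E ^ 3)"
      proof -
        have "a / b * (1 - a / b) = a * (b - a) / (b * b)" if "b \<noteq> 0" for a b :: real
          using that by (simp add: field_simps)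
        from this[of "E ^ 3" "(1 - t) ^ 3"] show ?thesis
          using E by (simp add: Y_def E_def[symmetric] power_divide)
      qed
      ultimately show ?thesis by (simp add: power_add[symmetric])
    qed
    have v: "1 - t ^ 3 = (1 - t) * (1 + t + t\<^sup>2)" by algebra
    have v0: "1 + t + t\<^sup>2 > 0" using t by (intro add_pos_pos) auto
    have "(G has_real_derivative hyp_D (1/3) (Y t) / (Y t * (1 - Y t)) * (- 9 * (1 - t)\<^sup>2 / E ^ 4)) (at t)"
      unfolding G_def using Y1 by (intro DERIV_chain2[OF has_derivative_hyp_F[OF s] dY]) auto
    hence dG: "(G has_real_derivative - (E\<^sup>2 / (t * (1 - t ^ 3))) * G1 t) (at t)"
    proof (rule DERIV_cong)
      define V where "V = 1 + t + t\<^sup>2"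
      have "V \<noteq> 0" using v0 by (simp add: V_def)
      show "hyp_D (1/3) (Y t) / (Y t * (1 - Y t)) * (- 9 * (1 - t)\<^sup>2 / E ^ 4) = - (E\<^sup>2 / (t * (1 - t ^ 3))) * G1 t"
      proof -
        have "d / (u ^ 3 * (9 * t * V) / E ^ 6) * (- 9 * u\<^sup>2 / E ^ 4) = - (E\<^sup>2 / (t * (u * V))) * d"
          if "u \<noteq> 0" for d u :: real
          using that t E \<open>V \<noteq> 0\<close> by (simp add: field_simps eval_nat_numeral)
        from this[of "1 - t" "hyp_D (1/3) (Y t)"] show ?thesis
          unfolding q v G1_def V_def[symmetric] using t by simp
      qed
    qed
    have "(G1 has_real_derivative (1/3) * (1 - 1/3) * hyp_F (1/3) (Y t) * (- 9 * (1 - t)\<^sup>2 / E ^ 4)) (at t)"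
      unfolding G1_def using Y1 by (intro DERIV_chain2[OF has_derivative_hyp_D[OF s] dY]) auto
    hence dG1: "(G1 has_real_derivative - 2 * (1 - t)\<^sup>2 / E ^ 4 * G t) (at t)"
      by (rule DERIV_cong) (simp add: G_def)
    have d1: "((\<lambda>t. 1 + 2 * t) has_real_derivative 2) (at t)"
      by (auto intro!: derivative_eq_intros)
    have d2: "((\<lambda>t. 2 * t * (1 - t ^ 3) / (1 + 2 * t)\<^sup>2) has_real_derivative
        ((2 - 8 * t ^ 3) * E\<^sup>2 - 2 * t * (1 - t ^ 3) * (4 * E)) / (E\<^sup>2 * E\<^sup>2)) (at t)"
      unfolding E_def
    proof (rule DERIV_divide)
      show "((\<lambda>t. 2 * t * (1 - t ^ 3)) has_real_derivative 2 - 8 * t ^ 3) (at t)"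
        by (rule derivative_eq_intros refl | simp)+ (simp add: eval_nat_numeral algebra_simps)
      show "((\<lambda>t. (1 + 2 * t)\<^sup>2) has_real_derivative 4 * (1 + 2 * t)) (at t)"
        by (auto intro!: derivative_eq_intros)
    qed (use E in \<open>simp add: E_def\<close>)
    have d3: "((\<lambda>t. 3 / (1 + 2 * t)) has_real_derivative - 6 / E\<^sup>2) (at t)"
      using E unfolding E_def by (auto intro!: derivative_eq_intros simp: power2_eq_square)
    have t0: "t * (1 - t ^ 3) \<noteq> 0" using t t3 by auto
    show ?thesis
      unfolding W_def
    proof (rule DERIV_cong[OF DERIV_add[OF DERIV_add[OF DERIV_mult[OF DERIV_mult[OF d1 dF] dG1]
        DERIV_mult[OF d2 DERIV_mult[OF dF dG]]] DERIV_mult[OF d3 DERIV_mult[OF dF1 dG]]]], goal_cases)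
      case 1
      \<comment> \<open>The derivative of \<open>W\<close> combines the four products of
        \<open>F\<close> or \<open>F1\<close> with \<open>G\<close> or \<open>G1\<close>; each of
        the four coefficients vanishes separately.\<close>
      have collect: "((2 * f + L * f1 * a1) * g1 + b * g * (a1 * f)) + (d * (f * g) + (L * f1 * g + N * g1 * f) * a2)
          + (d' * (f1 * g) + (h * f * g + N * g1 * f1) * a3) =
          (d + b * a1 + h * a3) * (f * g) + (L * a2 + d') * (f1 * g) + (2 + N * a2) * (f * g1) + (L * a1 + N * a3) * (f1 * g1)"
        for f f1 g g1 L N a1 a2 a3 b d d' h :: real by algebra
      have "(2 - 8 * t ^ 3) * E ^ 3 + 2 * t\<^sup>2 * E ^ 4 = 8 * t * (1 - t ^ 3) * E\<^sup>2 + 2 * (1 - t)\<^sup>2 * E\<^sup>2"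
        unfolding E_def by algebra
      hence "((2 - 8 * t ^ 3) * E\<^sup>2 - 2 * t * (1 - t ^ 3) * (4 * E)) / (E\<^sup>2 * E\<^sup>2) + - 2 * (1 - t)\<^sup>2 / E ^ 4 * (1 + 2 * t) + 2 / 3 * t\<^sup>2 * (3 / (1 + 2 * t)) = 0"
        unfolding E_def[symmetric] using E by (simp add: divide_simps) (simp add: eval_nat_numeral algebra_simps)
      moreover have "3 / (t * (1 - t ^ 3)) * (2 * t * (1 - t ^ 3) / (1 + 2 * t)\<^sup>2) + - 6 / E\<^sup>2 = 0"
        unfolding E_def[symmetric] using E t0 by (simp add: field_simps)
      moreover have "2 + - (E\<^sup>2 / (t * (1 - t ^ 3))) * (2 * t * (1 - t ^ 3) / (1 + 2 * t)\<^sup>2) = 0"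
        unfolding E_def[symmetric] using E t0 by (simp add: field_simps)
      moreover have "3 / (t * (1 - t ^ 3)) * (1 + 2 * t) + - (E\<^sup>2 / (t * (1 - t ^ 3))) * (3 / (1 + 2 * t)) = 0"
        unfolding E_def[symmetric] using E t0 by (simp add: field_simps power2_eq_square)
      ultimately show ?case by (subst collect) (simp only: mult_zero_left add_0_left)
    qed
  qed
  have "\<exists>c. \<forall>t\<in>{0<..<1}. W t = c"
    using has_field_derivative_at_within[OF dW]
    by (intro has_field_derivative_zero_constant convex_real_interval) blast
  then obtain c where c: "\<And>t. 0 < t \<Longrightarrow> t < 1 \<Longrightarrow> W t = c" by auto
  have near: "\<forall>\<^sub>F t in at_left 1. t \<in> {0<..<(1::real)}"
    by (rule eventually_at_left_real) auto
  have cube: "filterlim (\<lambda>t::real. t ^ 3) (at_left 1) (at_left 1)"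
    unfolding filterlim_at
  proof
    show "\<forall>\<^sub>F t in at_left 1. t ^ 3 \<in> {..<(1::real)} \<and> t ^ 3 \<noteq> 1"
      using near
    proof eventually_elim
      case (elim t)
      hence "t ^ 3 < 1" by (simp add: power_less_one_iff)
      thus ?case by auto
    qed
    have "((\<lambda>t::real. t ^ 3) \<longlongrightarrow> 1 ^ 3) (at_left 1)" by (intro tendsto_intros)
    thus "((\<lambda>t::real. t ^ 3) \<longlongrightarrow> 1) (at_left 1)" by simp
  qed
  have F1_lim: "(F1 \<longlongrightarrow> sin (pi * (1/3)) / pi) (at_left 1)"
    unfolding F1_def by (rule filterlim_compose[OF tendsto_hyp_D[OF s] cube])
  have F_lim: "((\<lambda>t. (1 - t ^ 3) * F t) \<longlongrightarrow> 0) (at_left 1)"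
    unfolding F_def by (rule filterlim_compose[OF tendsto_hyp_F[OF s] cube])
  have Y_lim: "(Y \<longlongrightarrow> 0) (at_left 1)"
  proof -
    have "(Y \<longlongrightarrow> ((1 - 1) / (1 + 2 * 1)) ^ 3) (at_left 1)"
      unfolding Y_def by (intro tendsto_intros) auto
    thus ?thesis by simp
  qed
  have Y_at: "filterlim Y (at 0) (at_left 1)"
    unfolding filterlim_at
  proof
    show "\<forall>\<^sub>F t in at_left 1. Y t \<in> UNIV \<and> Y t \<noteq> 0"
      using near by eventually_elim (auto simp: Y_def)
  qed (rule Y_lim)
  have G_lim: "(G \<longlongrightarrow> 1) (at_left 1)"
    unfolding G_def using isCont_tendsto_compose[OF isCont_hyp_F[OF s, of 0] Y_lim] hyp_F_0[OF s] by simp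
  \<comment> \<open>\<open>hyp_D\<close> vanishes at 0, so the quotient tends to its derivative
    there. As \<open>Y t\<close> is of order \<open>(1 - t)^3\<close>, \<open>G1 t\<close> is
    negligible even after division by \<open>1 - t ^ 3\<close>.\<close>
  have "((\<lambda>u. hyp_D (1/3) u / u) \<longlongrightarrow> (1/3) * (1 - 1/3) * hyp_F (1/3) 0) (at 0)"
    using has_derivative_hyp_D[OF s, of 0] hyp_D_0[OF s] by (simp add: DERIV_def)
  from filterlim_compose[OF this Y_at]
  have 1: "((\<lambda>t. G1 t / Y t) \<longlongrightarrow> (1/3) * (1 - 1/3) * hyp_F (1/3) 0) (at_left 1)"
    by (simp add: G1_def)
  have "((\<lambda>t::real. (1 - t)\<^sup>2 / ((1 + 2 * t) ^ 3 * (1 + t + t\<^sup>2))) \<longlongrightarrow>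
      (1 - 1)\<^sup>2 / ((1 + 2 * 1) ^ 3 * (1 + 1 + 1\<^sup>2))) (at_left 1)"
    by (intro tendsto_intros) auto
  from tendsto_mult[OF 1 this]
  have "((\<lambda>t. G1 t / Y t * ((1 - t)\<^sup>2 / ((1 + 2 * t) ^ 3 * (1 + t + t\<^sup>2)))) \<longlongrightarrow> 0) (at_left 1)"
    by simp
  moreover have "\<forall>\<^sub>F t in at_left 1. G1 t / Y t * ((1 - t)\<^sup>2 / ((1 + 2 * t) ^ 3 * (1 + t + t\<^sup>2))) = G1 t / (1 - t ^ 3)"
    using near
  proof eventually_elim
    case (elim t)
    define V where "V = 1 + t + t\<^sup>2"
    have "1 - t ^ 3 = (1 - t) * V" unfolding V_def by algebra
    have "V > 0" unfolding V_def using elim by (intro add_pos_pos) auto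
    show ?case
    proof -
      have "d / (u / E) ^ 3 * (u\<^sup>2 / (E ^ 3 * V)) = d / (u * V)" if "u \<noteq> 0" "E \<noteq> 0" for d u E
        using that \<open>V > 0\<close> by (simp add: field_simps eval_nat_numeral)
      from this[of "1 - t" "1 + 2 * t" "G1 t"] show ?thesis
        using elim \<open>1 - t ^ 3 = (1 - t) * V\<close> unfolding V_def[symmetric] Y_def by simp
    qed
  qed
  ultimately have G1_lim: "((\<lambda>t. G1 t / (1 - t ^ 3)) \<longlongrightarrow> 0) (at_left 1)"
    by (rule Lim_transform_eventually)
  \<comment> \<open>Moving \<open>1 - t ^ 3\<close> from \<open>G1\<close> to \<open>F\<close> gives
    every factor a finite limit; only the term with \<open>F1 * G\<close> survives.\<close>
  have "((\<lambda>t. (1 + 2 * t) * ((1 - t ^ 3) * F t) * (G1 t / (1 - t ^ 3)) +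
      2 * t / (1 + 2 * t)\<^sup>2 * ((1 - t ^ 3) * F t) * G t + 3 / (1 + 2 * t) * (F1 t * G t)) \<longlongrightarrow>
      (1 + 2 * 1) * 0 * 0 + 2 * 1 / (1 + 2 * 1)\<^sup>2 * 0 * 1 + 3 / (1 + 2 * 1) * (sin (pi * (1/3)) / pi * 1)) (at_left 1)"
    by (intro tendsto_intros F_lim G1_lim F1_lim G_lim) auto
  moreover have "\<forall>\<^sub>F t in at_left 1. (1 + 2 * t) * ((1 - t ^ 3) * F t) * (G1 t / (1 - t ^ 3)) +
      2 * t / (1 + 2 * t)\<^sup>2 * ((1 - t ^ 3) * F t) * G t + 3 / (1 + 2 * t) * (F1 t * G t) = c"
    using near
  proof eventually_elim
    case (elim t)
    have "1 - t ^ 3 \<noteq> 0" using elim power_less_one_iff[of t 3] by auto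
    hence "(1 + 2 * t) * ((1 - t ^ 3) * F t) * (G1 t / (1 - t ^ 3)) +
      2 * t / (1 + 2 * t)\<^sup>2 * ((1 - t ^ 3) * F t) * G t + 3 / (1 + 2 * t) * (F1 t * G t) = W t"
      by (simp add: W_def)
    thus ?case using c elim by simp
  qed
  ultimately have "((\<lambda>t. c) \<longlongrightarrow> sin (pi * (1/3)) / pi) (at_left (1::real))"
    by (subst (asm) tendsto_cong) auto
  hence "c = sin (pi * (1/3)) / pi"
    by (simp add: tendsto_const_iff)
  also have "\<dots> = sqrt 3 / (2 * pi)"
    by (simp add: sin_60)
  finally show ?thesis
    using c[OF k] by (simp add: W_def F_def F1_def G_def G1_def Y_def x_def y_def e_def f_def f1_def g_def g1_def)
qed

section \<open>Evaluation of the weighted series\<close>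

theorem theorem4:
  fixes k :: real
  assumes "0 < k" and "k < 1"
  shows "(\<lambda>n. pochhammer (1/3) n * pochhammer (2/3) n / (fact n)^2 * legendre_term n k
              * (C3 k * real n ^ 3 + C2 k * real n ^ 2 + C1 k * real n + C0 k))
         sums (sqrt 3 * (1 + 2*k)^4 * (1 - 2*k + 4*k^2) / pi)"
proof -
  have s: "0 < (1/3::real)" "1/3 < (1::real)" by auto
  define x where "x = k ^ 3"
  define y where "y = ((1 - k) / (1 + 2 * k)) ^ 3"
  define e where "e = 1 + 2 * k"
  define f where "f = hyp_F (1/3) x"
  define f1 where "f1 = hyp_D (1/3) x"
  define g where "g = hyp_F (1/3) y"
  define g1 where "g1 = hyp_D (1/3) y"
  define r where "r = 1 - x - y"
  define p where "p = x * (1 - x)"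
  define q where "q = y * (1 - y)"
  define m where "m = p + q"
  define m1 where "m1 = (1 - 2 * x) * p + (1 - 2 * y) * q"
  define A where "A = f1 * g + f * g1"
  define C where "C = (1/3) * (1 - 1/3) * (p * f * g1 + q * f1 * g)"
  define B where "B = (1/3) * (1 - 1/3) * m * (f * g) + 2 * (f1 * g1)"
  define a where "a = (\<lambda>n. hyp_coeff (1/3) n * leg_sep n x y)"
  have xy: "0 < x" "0 < y" "x + y < 1"
    using cubic_param_bounds[OF assms] assms by (auto simp: x_def y_def)
  have S0: "a sums (f * g)"
    unfolding a_def f_def g_def by (rule brafman[OF s xy])
  note S = brafman_euler_derivatives[OF s xy, folded f_def f1_def g_def g1_def r_def p_def q_def a_def,
      folded m_def m1_def A_def C_def, folded B_def]
  have S1: "(\<lambda>n. real n * a n) sums (A / r)"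
    and S2: "(\<lambda>n. real n ^ 2 * a n) sums (B / r^2 + m * A / r^3)"
    and S3: "(\<lambda>n. real n ^ 3 * a n) sums
      (((1/3) * (1 - 1/3) * (m1 * (f * g) + m * A) + 2 * C) / r^3 + (3 * m * B + m1 * A) / r^4 + 3 * m^2 * A / r^5)"
    using S by (simp_all add: a_def)
  define V where "V = C3 k * (((1/3) * (1 - 1/3) * (m1 * (f * g) + m * A) + 2 * C) / r^3 + (3 * m * B + m1 * A) / r^4 + 3 * m^2 * A / r^5)
    + C2 k * (B / r^2 + m * A / r^3) + C1 k * (A / r) + C0 k * (f * g)"
  have "(\<lambda>n. C3 k * (real n ^ 3 * a n) + C2 k * (real n ^ 2 * a n) + C1 k * (real n * a n) + C0 k * a n) sums V"
    unfolding V_def by (intro sums_add sums_mult S0 S1 S2 S3)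
  also have "(\<lambda>n. C3 k * (real n ^ 3 * a n) + C2 k * (real n ^ 2 * a n) + C1 k * (real n * a n) + C0 k * a n) =
    (\<lambda>n. a n * (C3 k * real n ^ 3 + C2 k * real n ^ 2 + C1 k * real n + C0 k))"
    by (simp add: fun_eq_iff algebra_simps)
  also have "a = (\<lambda>n. pochhammer (1/3) n * pochhammer (2/3) n / (fact n)^2 * legendre_term n k)"
    using legendre_term_eq_leg_sep[OF assms] by (simp add: a_def x_def y_def hyp_coeff_def)
  also have "V = sqrt 3 * (1 + 2*k)^4 * (1 - 2*k + 4*k^2) / pi"
  proof -
    define u where "u = 1 - 2*k + 4*k^2"
    define v where "v = 1 + k + k^2"
    \<comment> \<open>\<open>W\<close> is the common factor in \<open>C3 = 9 r^2 W\<close> and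
      \<open>C2 = -27 m W\<close>. The polynomial \<open>j\<close> on the next line is the quotient
      of \<open>m1\<close> by \<open>r\<close>.\<close>
    define W where "W = e ^ 6 / v"
    define j where "j = (x + y) - 2 * (x + y)^2 + 6 * x * y"
    have e: "e > 0" using assms by (simp add: e_def)
    have v: "v > 0" unfolding v_def using assms by (intro add_pos_pos) auto
    have r: "r > 0" using xy by (simp add: r_def)
    have y: "y = (1 - k) ^ 3 / e ^ 3" by (simp add: y_def e_def power_divide)
    have m1: "m1 = r * j"
      unfolding m1_def r_def j_def p_def q_def by algebra
    \<comment> \<open>Multiplication by \<open>e ^ 3\<close> or \<open>e ^ 6\<close> clears the
      denominators of \<open>y\<close>, so that the identities below become polynomial in
      \<open>k\<close>.\<close>
    have er: "e ^ 3 * r = e ^ 3 - k ^ 3 * e ^ 3 - (1 - k) ^ 3"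
      using e by (simp add: r_def x_def y right_diff_distrib)
    have ep: "e ^ 6 * p = k ^ 3 * (1 - k ^ 3) * e ^ 6"
      by (simp add: p_def x_def)
    have e6: "e ^ 6 = (e ^ 3)\<^sup>2" by (simp flip: power_mult)
    have e3y: "e ^ 3 * y = (1 - k) ^ 3" using e by (simp add: y)
    have eq: "e ^ 6 * q = (1 - k) ^ 3 * (e ^ 3 - (1 - k) ^ 3)"
      unfolding e6 q_def e3y[symmetric] by algebra
    have ej: "e ^ 6 * j = (k ^ 3 * e ^ 3 + (1 - k) ^ 3) * e ^ 3 - 2 * (k ^ 3 * e ^ 3 + (1 - k) ^ 3)\<^sup>2 + 6 * k ^ 3 * (1 - k) ^ 3 * e ^ 3"
      unfolding e6 j_def x_def e3y[symmetric] by algebra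
    have C3: "C3 k = 9 * r\<^sup>2 * W"
    proof -
      have "e ^ 3 - k ^ 3 * e ^ 3 - (1 - k) ^ 3 = k * (1 - k) * ((3 + 4*k + 2*k^2) * (3 + 2*k + 4*k^2))"
        unfolding e_def by algebra
      hence "9 * (k * (1 - k) * ((3 + 4*k + 2*k^2) * (3 + 2*k + 4*k^2)))\<^sup>2 = 9 * (e ^ 3 * r)\<^sup>2"
        unfolding er by simp
      hence "9 * (k - 1)^2 * k^2 * (3 + 4*k + 2*k^2)^2 * (3 + 2*k + 4*k^2)^2 = 9 * r\<^sup>2 * e ^ 6"
        unfolding e6 by algebra
      thus ?thesis by (simp add: C3_def W_def v_def)
    qed
    have C2: "C2 k = - 27 * m * W"
    proof -
      have "e ^ 6 * m = k ^ 3 * (1 - k ^ 3) * e ^ 6 + (1 - k) ^ 3 * (e ^ 3 - (1 - k) ^ 3)"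
        unfolding m_def distrib_left ep eq ..
      also have "\<dots> = v * (k * (1 - k) * (9 - 18*k + 10*k^2 + 12*k^3 + 60*k^4 + 160*k^5 + 240*k^6 + 192*k^7 + 64*k^8))"
        unfolding v_def e_def by algebra
      finally show ?thesis using v by (simp add: W_def C2_def field_simps)
    qed
    \<comment> \<open>\<open>I1\<close>, \<open>I2\<close> and \<open>I3\<close> evaluate the
      coefficients of \<open>f * g\<close>, \<open>f1 * g\<close> and \<open>f * g1\<close> in
      \<open>V\<close>, the last two up to division by \<open>r\<close>. Each is
      \<open>2 * u * e ^ 4\<close> times the matching coefficient in
      \<open>cubic_legendre_relation\<close>.\<close>
    have I1: "2 * W * j + C0 k = 4 * u * e\<^sup>2 * (k * (1 - k ^ 3))"
    proof -
      have "2 * (e ^ 6 * j) + C0 k * v = 4 * u * e\<^sup>2 * (k * (1 - k ^ 3)) * v"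
        unfolding ej C0_def v_def u_def unfolding e_def by algebra
      thus ?thesis using v by (simp add: W_def field_simps)
    qed
    have I2: "9 * W * j + 2 * W * (m + 2 * q) + C1 k = 6 * u * e ^ 3 * r"
    proof -
      have "9 * (e ^ 6 * j) + 2 * (e ^ 6 * p) + 6 * (e ^ 6 * q) + C1 k * v = 6 * u * (e ^ 3 * r) * v"
        unfolding ej er ep eq C1_def v_def u_def unfolding e_def by algebra
      thus ?thesis using v by (simp add: W_def m_def field_simps)
    qed
    have I3: "9 * W * j + 2 * W * (m + 2 * p) + C1 k = 2 * u * e ^ 5 * r"
    proof -
      have "9 * (e ^ 6 * j) + 6 * (e ^ 6 * p) + 2 * (e ^ 6 * q) + C1 k * v = 2 * u * e\<^sup>2 * (e ^ 3 * r) * v"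
        unfolding ej er ep eq C1_def v_def u_def unfolding e_def by algebra
      also have "\<dots> = 2 * u * e ^ 5 * r * v" by algebra
      finally show ?thesis using v by (simp add: W_def m_def field_simps)
    qed
    have "V = (2 * W * j + C0 k) * (f * g) + (9 * W * j + 2 * W * (m + 2 * q) + C1 k) / r * (f1 * g)
        + (9 * W * j + 2 * W * (m + 2 * p) + C1 k) / r * (f * g1)"
    proof -
      define K where "K = (1/3) * (1 - 1/3) * (m1 * (f * g) + m * A) + 2 * C"
      \<comment> \<open>The terms with \<open>B\<close> and with \<open>m^2 * A\<close> cancel
        between \<open>a\<close> and \<open>b\<close>. Since \<open>B\<close> alone contains
        \<open>f1 * g1\<close>, that product disappears.\<close>
      have a: "9 * r\<^sup>2 * W * (K / r^3 + (3 * m * B + r * j * A) / r^4 + 3 * m^2 * A / r^5) =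
          (9 * W * K) / r + 27 * W * m * B / r^2 + (9 * W * j * A) / r + 27 * W * m^2 * A / r^3"
        using r by (simp add: divide_simps) (simp add: algebra_simps eval_nat_numeral)
      have b: "- 27 * m * W * (B / r^2 + m * A / r^3) = - (27 * W * m * B / r^2) - 27 * W * m^2 * A / r^3"
        by (simp add: algebra_simps power2_eq_square)
      have "V = (9 * W * K) / r + (9 * W * j * A) / r + C1 k * (A / r) + C0 k * (f * g)"
        unfolding V_def C3 C2 unfolding K_def[symmetric] unfolding m1 a b by linarith
      also have "9 * W * K = r * (2 * W * j * (f * g)) + (2 * W * (m + 2 * q) * (f1 * g) + 2 * W * (m + 2 * p) * (f * g1))"
        unfolding K_def m1 A_def C_def by (simp add: field_simps)
      also have "\<dots> / r = 2 * W * j * (f * g) + (2 * W * (m + 2 * q) * (f1 * g) + 2 * W * (m + 2 * p) * (f * g1)) / r"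
        using r by (simp add: add_divide_distrib)
      finally show ?thesis
        unfolding A_def by (simp add: algebra_simps add_divide_distrib)
    qed
    also have "\<dots> = 2 * u * e ^ 4 * (e * f * g1 + 2 * k * (1 - k ^ 3) / e\<^sup>2 * (f * g) + 3 / e * (f1 * g))"
    proof -
      have "6 * u * e ^ 3 * r / r = 6 * u * e ^ 3" "2 * u * e ^ 5 * r / r = 2 * u * e ^ 5" using r by simp_all
      moreover have "e ^ 4 * (2 * k * (1 - k ^ 3) / e\<^sup>2) = e\<^sup>2 * (2 * k * (1 - k ^ 3))" "e ^ 4 * (3 / e) = 3 * e ^ 3"
        using e by (simp_all add: eval_nat_numeral)
      ultimately show ?thesis
        unfolding I1 I2 I3 by algebra
    qed
    also have "e * f * g1 + 2 * k * (1 - k ^ 3) / e\<^sup>2 * (f * g) + 3 / e * (f1 * g) = sqrt 3 / (2 * pi)"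
      using cubic_legendre_relation[OF assms]
      by (simp add: e_def f_def f1_def g_def g1_def x_def y_def)
    also have "2 * u * e ^ 4 * (sqrt 3 / (2 * pi)) = sqrt 3 * e ^ 4 * u / pi" by simp
    finally show ?thesis by (simp only: u_def e_def)
  qed
  finally show ?thesis .
qed

end
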